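(* Let $M$ and $N$ be atomic JBW$^*$-triples, and let $\Phi : \mathcal{U}_{min}(M) \to \mathcal{U}_{min}(N)$ be a bijective transformation preserving triple transition pseudo-probabilities, i.e., $TTP(\Phi(v), \Phi(e))=\varphi_{\Phi(e)} (\Phi(v)) = \varphi_{e} (v)=TTP(v,e)$ for all $e,v\in\mathcal{U}_{min} (M)$. Then there exists a bijective complex-linear mapping $T_0: \mathrm{soc}(M) \to \mathrm{soc}(N)$ whose restriction to $\mathcal{U}_{min} (M)$ is $\Phi$.
   Context: A JB$^*$-triple is a complex Banach space $E$ with a continuous triple product $\{\cdot,\cdot,\cdot\}:E\times E\times E\to E$, symmetric and bilinear in the first and third variables and conjugate-linear in the middle one, such that, writing $L(a,b)x=\{a,b,x\}$: (a) $L(a,b) L(x,y) = L(x,y) L(a,b) + L(L(a,b)x,y) - L(x,L(b,a)y)$ for all $a,b,x,y\in E$; (b) each $L(a,a)$ is a hermitian operator with non-negative spectrum; (c) $\|\{a,a,a\}\|=\|a\|^3$ for all $a\in E$. A JBW$^*$-triple is a JB$^*$-triple which is a dual Banach space; it has a unique isometric predual, denoted $M_*$. A tripotent is an element $e$ with $\{e,e,e\}=e$. For a tripotent $e$, $E=E_0(e)\oplus E_1(e)\oplus E_2(e)$ where $E_k(e)=\{x\in E: L(e,e)x=\frac{k}{2}x\}$; the corresponding projection onto $E_k(e)$ is denoted $P_k(e)$. A tripotent $e$ is minimal if $E_2(e)=\mathbb{C}e\neq\{0\}$. $\mathcal{U}_{min}(E)$ denotes the set of minimal tripotents of $E$. A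 JBW$^*$-triple is atomic if it is the weak$^*$-closure of the linear span of its minimal tripotents (equivalently, an $\ell_\infty$-sum of Cartan factors). The socle $\mathrm{soc}(E)$ is the (not necessarily closed) linear span of $\mathcal{U}_{min}(E)$. For each minimal tripotent $e$ in a JBW$^*$-triple $M$ there is a unique extreme point $\varphi_e$ of the closed unit ball of $M_*$ with $P_2(e)(x)=\varphi_e(x)e$ for all $x\in M$. For minimal tripotents $e,v$ in $M$, the triple transition pseudo-probability from $e$ to $v$ is the complex number $TTP(e,v)=\varphi_v(e)$. *)

theory Defs
  imports "HOL-Analysis.Analysis"
begin

class complex_banach = banach +
  fixes scaleC :: "complex \<Rightarrow> 'a \<Rightarrow> 'a" (infixr \<open>*\<^sub>C\<close> 75)
  assumes scaleC_add_right: "c *\<^sub>C (x + y) = c *\<^sub>C x + c *\<^sub>C y"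
    and scaleC_add_left: "(c + d) *\<^sub>C x = c *\<^sub>C x + d *\<^sub>C x"
    and scaleC_scaleC: "c *\<^sub>C d *\<^sub>C x = (c * d) *\<^sub>C x"
    and scaleC_of_real: "complex_of_real r *\<^sub>C x = r *\<^sub>R x"
    and norm_scaleC: "norm (c *\<^sub>C x) = cmod c * norm x"

global_interpretation complex_vector:
  vector_space "scaleC :: complex \<Rightarrow> 'a \<Rightarrow> 'a::complex_banach"
  defines cspan = complex_vector.span
  by unfold_locales
    (simp_all add: scaleC_add_right scaleC_add_left scaleC_scaleC
      scaleC_of_real[of 1, simplified])

text \<open>For a bounded operator \<open>T\<close>, \<open>exp_operator T\<close> is \<open>exp T = (\<Sum>n. T\<^sup>n / n!)\<close>, and \<open>T\<close> is
  hermitian if \<open>exp (i t T)\<close> is an isometry for all real \<open>t\<close>; it is surjective, with inverse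
  \<open>exp (- i t T)\<close>.\<close>

definition exp_operator :: "('a::complex_banach \<Rightarrow> 'a) \<Rightarrow> 'a \<Rightarrow> 'a" where
  "exp_operator T x = (\<Sum>n. (T ^^ n) x /\<^sub>R fact n)"

definition hermitian :: "('a::complex_banach \<Rightarrow> 'a) \<Rightarrow> bool" where
  "hermitian T \<longleftrightarrow>
    (\<forall>t::real. \<forall>x. norm (exp_operator (\<lambda>y. (\<i> * of_real t) *\<^sub>C T y) x) = norm x)"

text \<open>The inverse of \<open>\<mu> - T\<close> is automatically complex-linear for complex-linear \<open>T\<close>.\<close>

definition operator_spectrum :: "('a::complex_banach \<Rightarrow> 'a) \<Rightarrow> complex set" where
  "operator_spectrum T = {\<mu>. \<not> (\<exists>S. bounded_linear S \<and>
     (\<forall>x. S (\<mu> *\<^sub>C x - T x) = x) \<and> (\<forall>x. \<mu> *\<^sub>C S x - T (S x) = x))}"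

type_synonym 'a triple_product = "'a \<Rightarrow> 'a \<Rightarrow> 'a \<Rightarrow> 'a"

locale jb_triple =
  fixes triple :: "'a::complex_banach triple_product"
  assumes triple_symmetric: "triple a b c = triple c b a"
    and triple_add_left: "triple (a + a') b c = triple a b c + triple a' b c"
    and triple_scaleC_left: "triple (s *\<^sub>C a) b c = s *\<^sub>C triple a b c"
    and triple_add_middle: "triple a (b + b') c = triple a b c + triple a b' c"
    and triple_scaleC_middle: "triple a (s *\<^sub>C b) c = cnj s *\<^sub>C triple a b c"
    and continuous_triple: "continuous_on UNIV (\<lambda>(a, b, c). triple a b c)"
    and jordan_identity:
      "triple a b (triple x y z) =
        triple x y (triple a b z) + triple (triple a b x) y z - triple x (triple b a y) z"
    and hermitian_triple: "hermitian (triple a a)"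
    and spectrum_triple: "operator_spectrum (triple a a) \<subseteq> \<real>\<^sub>\<ge>\<^sub>0"
    and norm_triple: "norm (triple a a a) = norm a ^ 3"

definition tripotent :: "'a triple_product \<Rightarrow> 'a \<Rightarrow> bool" where
  "tripotent triple e \<longleftrightarrow> triple e e e = e"

definition peirce_space :: "'a::complex_banach triple_product \<Rightarrow> nat \<Rightarrow> 'a \<Rightarrow> 'a set" where
  "peirce_space triple k e = {x. triple e e x = (of_nat k / 2) *\<^sub>C x}"

definition peirce_proj :: "'a::complex_banach triple_product \<Rightarrow> nat \<Rightarrow> 'a \<Rightarrow> 'a \<Rightarrow> 'a" where
  "peirce_proj triple k e x =
    (THE y. \<exists>z. (\<forall>j\<le>2. z j \<in> peirce_space triple j e) \<and> x = (\<Sum>j\<le>2. z j) \<and> y = z k)"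

definition min_tripotents :: "'a::complex_banach triple_product \<Rightarrow> 'a set" where
  "min_tripotents triple =
    {e. tripotent triple e \<and> peirce_space triple 2 e = range (\<lambda>c. c *\<^sub>C e) \<and>
        peirce_space triple 2 e \<noteq> {0}}"

definition soc :: "'a::complex_banach triple_product \<Rightarrow> 'a set" where
  "soc triple = cspan (min_tripotents triple)"

text \<open>Complex-linear bounded functionals form a subset of the real-linear ones; on it the
  operator norm is the usual dual norm, and \<open>blinfun_mult_right c o\<^sub>L f\<close> is the complex multiple
  \<open>c f\<close>. A predual of a complex Banach space \<open>E\<close> is represented by its canonical image in the
  dual of \<open>E\<close>: a norm-closed complex subspace \<open>P\<close> such that evaluation is an isometric
  isomorphism of \<open>E\<close> onto the Banach dual of \<open>P\<close>.\<close>

definition is_predual :: "('a::complex_banach \<Rightarrow>\<^sub>L complex) set \<Rightarrow> bool" where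
  "is_predual P \<longleftrightarrow>
    (\<forall>f\<in>P. \<forall>c x. f (c *\<^sub>C x) = c * f x) \<and>
    0 \<in> P \<and> (\<forall>f\<in>P. \<forall>g\<in>P. f + g \<in> P) \<and> (\<forall>c. \<forall>f\<in>P. blinfun_mult_right c o\<^sub>L f \<in> P) \<and>
    closed P \<and>
    (\<forall>x. norm x = (SUP f\<in>P \<inter> cball 0 1. cmod (blinfun_apply f x))) \<and>
    (\<forall>G :: ('a \<Rightarrow>\<^sub>L complex) \<Rightarrow> complex.
      (\<forall>f\<in>P. \<forall>g\<in>P. G (f + g) = G f + G g) \<and>
      (\<forall>c. \<forall>f\<in>P. G (blinfun_mult_right c o\<^sub>L f) = c * G f) \<and>
      (\<exists>K. \<forall>f\<in>P. cmod (G f) \<le> K * norm f)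
      \<longrightarrow> (\<exists>x. \<forall>f\<in>P. G f = f x))"

definition weak_star_topology :: "('a::complex_banach \<Rightarrow>\<^sub>L complex) set \<Rightarrow> 'a topology" where
  "weak_star_topology P = topology_generated_by {blinfun_apply f -` U |f U. f \<in> P \<and> open U}"

text \<open>The predual is carried as part of the structure; by uniqueness of the predual of a
  JBW*-triple this is no additional datum.\<close>

locale jbw_triple = jb_triple triple
  for triple :: "'a::complex_banach triple_product" +
  fixes predual :: "('a \<Rightarrow>\<^sub>L complex) set"
  assumes is_predual: "is_predual predual"

locale atomic_jbw_triple = jbw_triple +
  assumes atomic: "weak_star_topology predual closure_of cspan (min_tripotents triple) = UNIV"

definition support_functional ::
    "'a::complex_banach triple_product \<Rightarrow> ('a \<Rightarrow>\<^sub>L complex) set \<Rightarrow> 'a \<Rightarrow> 'a \<Rightarrow>\<^sub>L complex" where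
  "support_functional triple predual e =
    (THE f. f extreme_point_of (predual \<inter> cball 0 1) \<and>
       (\<forall>x. peirce_proj triple 2 e x = f x *\<^sub>C e))"

definition TTP ::
    "'a::complex_banach triple_product \<Rightarrow> ('a \<Rightarrow>\<^sub>L complex) set \<Rightarrow> 'a \<Rightarrow> 'a \<Rightarrow> complex" where
  "TTP triple predual e v = support_functional triple predual v e"

end

theory Submission
  imports Defs
begin

text \<open>For minimal tripotents \<open>e\<close> the functional \<open>\<phi>\<^sub>e\<close> is read off from the algebraic Peirce projection
  \<open>P\<^sub>2(e) = Q(e)\<^sup>2\<close>. It belongs to the predual because the norm is Frechet differentiable at \<open>e\<close>
  with derivative the real part of \<open>\<phi>\<^sub>e\<close>, a consequence of \<open>\<parallel>{a,a,a}\<parallel> = \<parallel>a\<parallel>\<^sup>3\<close>. The map \<open>T\<^sub>0\<close> sends \<open>x\<close> to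
  the unique \<open>z\<close> in the socle of \<open>N\<close> with \<open>\<phi>\<^bsub>\<Phi>(e)\<^esub>(z) = \<phi>\<^sub>e(x)\<close> for all \<open>e\<close>; everything rests on
  the functionals \<open>\<phi>\<^sub>e\<close> separating the points of the socle. If all \<open>\<phi>\<^sub>e\<close> vanish at \<open>y\<close>, rotating \<open>e\<close> by
  automorphisms gives \<open>{x,x,e} = 0\<close> for the component \<open>x\<close> of \<open>y\<close> in \<open>E\<^sub>1(e)\<close>, which forces \<open>x = 0\<close>.
  Thus \<open>y\<close> is orthogonal to all \<open>e\<close>, hence to itself if it lies in the socle.\<close>

subsection \<open>Peirce decomposition\<close>

context jb_triple
begin

section \<open>Multilinearity and boundedness of the triple product\<close>

lemma scaleR_eq_scaleC: "r *\<^sub>R (x::'a) = complex_of_real r *\<^sub>C x"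
  by (simp add: scaleC_of_real)

lemma triple_add_right: "triple a b (c + c') = triple a b c + triple a b c'"
  by (metis triple_symmetric triple_add_left)

lemma triple_scaleC_right: "triple a b (s *\<^sub>C c) = s *\<^sub>C triple a b c"
  by (metis triple_symmetric triple_scaleC_left)

lemma linear_triple_left: "linear (\<lambda>a. triple a b c)"
  by (intro linearI) (simp_all add: triple_add_left triple_scaleC_left scaleR_eq_scaleC)

lemma linear_triple_middle: "linear (\<lambda>b. triple a b c)"
  by (intro linearI) (simp_all add: triple_add_middle triple_scaleC_middle scaleR_eq_scaleC)

lemma linear_triple_right: "linear (\<lambda>c. triple a b c)"
  by (intro linearI) (simp_all add: triple_add_right triple_scaleC_right scaleR_eq_scaleC)

lemmas triple_linear_simps =
  linear_add[OF linear_triple_left] linear_add[OF linear_triple_middle] linear_add[OF linear_triple_right]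
  linear_diff[OF linear_triple_left] linear_diff[OF linear_triple_middle] linear_diff[OF linear_triple_right]
  linear_neg[OF linear_triple_left] linear_neg[OF linear_triple_middle] linear_neg[OF linear_triple_right]
  linear_scale[OF linear_triple_left] linear_scale[OF linear_triple_middle] linear_scale[OF linear_triple_right]
  linear_0[OF linear_triple_left] linear_0[OF linear_triple_middle] linear_0[OF linear_triple_right]

lemma triple_scaleR:
  "triple (r *\<^sub>R a) (s *\<^sub>R b) (t *\<^sub>R c) = (r * s * t) *\<^sub>R triple a b c"
  by (simp add: triple_linear_simps mult_ac)

text \<open>Continuity at the origin bounds the product on a small ball, and real homogeneity
  rescales arbitrary arguments into that ball.\<close>

lemma triple_bounded: "\<exists>K\<ge>0. \<forall>a b c. norm (triple a b c) \<le> K * norm a * norm b * norm c"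
proof -
  have cont: "isCont (\<lambda>(a, b, c). triple a b c) (0, 0, 0)"
    using continuous_triple by (simp add: continuous_on_eq_continuous_at)
  obtain d where d: "d > 0"
    "\<And>p. dist p (0, 0, 0) < d \<Longrightarrow> dist ((\<lambda>(a, b, c). triple a b c) p) (triple 0 0 0) < 1"
    using cont[unfolded continuous_at_eps_delta, rule_format, OF zero_less_one] by auto
  \<comment> \<open>With radius \<open>d / 4\<close> the three norms add up to less than
    \<open>d\<close>.\<close>
  have small: "norm (triple a b c) < 1"
    if "norm a \<le> d / 4" "norm b \<le> d / 4" "norm c \<le> d / 4" for a b c
  proof -
    have "norm (a, b, c) \<le> norm a + norm (b, c)" by (rule norm_Pair_le)
    also have "norm (b, c) \<le> norm b + norm c" by (rule norm_Pair_le)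
    finally have "norm (a, b, c) < d" using that \<open>d > 0\<close> by simp
    moreover have "dist (a, b, c) (0, 0, 0) = norm (a, b, c)"
      by (simp add: dist_norm)
    ultimately show ?thesis
      using d(2)[of "(a, b, c)"] by (simp add: triple_linear_simps)
  qed
  define u where "u = (\<lambda>x::'a. (d / (4 * norm x)) *\<^sub>R x)"
  have nu: "norm (u x) \<le> d / 4" for x
    using \<open>d > 0\<close> by (cases "x = 0") (simp_all add: u_def)
  have unscale: "x = (4 * norm x / d) *\<^sub>R u x" for x
    using \<open>d > 0\<close> by (cases "x = 0") (simp_all add: u_def)
  show ?thesis
  proof (intro exI[of _ "(4 / d) ^ 3"] conjI allI)
    fix a b c
    let ?n = "\<lambda>x::'a. 4 * norm x / d"
    have "triple a b c = triple (?n a *\<^sub>R u a) (?n b *\<^sub>R u b) (?n c *\<^sub>R u c)"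
      by (simp only: unscale[symmetric])
    also have "\<dots> = (?n a * ?n b * ?n c) *\<^sub>R triple (u a) (u b) (u c)"
      by (rule triple_scaleR)
    finally have "norm (triple a b c) = (?n a * ?n b * ?n c) * norm (triple (u a) (u b) (u c))"
      using \<open>d > 0\<close> by (simp add: abs_mult)
    also have "\<dots> \<le> (?n a * ?n b * ?n c) * 1"
      using small[OF nu nu nu] \<open>d > 0\<close> by (intro mult_left_mono) (auto intro: less_imp_le)
    finally show "norm (triple a b c) \<le> (4 / d) ^ 3 * norm a * norm b * norm c"
      by (simp add: power3_eq_cube)
  qed (use \<open>d > 0\<close> in simp)
qed

lemma triple_cube_eq_0_iff: "triple x x x = 0 \<longleftrightarrow> x = 0"
  using norm_triple[of x] by auto

lemma triple_jordan:
  "triple a b (triple x y z) =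
    triple (triple a b x) y z - triple x (triple b a y) z + triple x y (triple a b z)"
  using jordan_identity[of a b x y z] by simp

text \<open>In the Jordan identity with five equal entries the term \<open>{x,x,{x,x,x}}\<close>
  occurs on both sides and cancels.\<close>

lemma jordan_power5: "triple x (triple x x x) x = triple x x (triple x x x)"
  using triple_jordan[of x x x x x] triple_symmetric by (metis add_diff_cancel_left' eq_diff_eq)

section \<open>Identities for \<open>L = L(e,e)\<close> and \<open>Q x = {e,x,e}\<close> at a
  tripotent\<close>

context
  fixes e
  assumes e: "triple e e e = e"
begin

text \<open>The Jordan identity for \<open>L(x,e)\<close> applied to \<open>{e,e,e}\<close>. The
  polynomial \<open>2 r^2 - r\<close> is 0 at 0 and 1/2 and is 1 at 1, so it turns \<open>L\<close>
  into the projection onto \<open>E_2(e)\<close>.\<close>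

lemma Q_squared: "triple e (triple e x e) e = 2 *\<^sub>R triple e e (triple e e x) - triple e e x"
  using triple_jordan[of x e e e e] e triple_symmetric[of x e e]
    triple_symmetric[of "triple e e x" e e] 
  by (simp add: scaleR_2 algebra_simps)

text \<open>Two instances of the Jordan identity are linear equations between \<open>L Q\<close>,
  \<open>Q L\<close> and \<open>Q\<close>; eliminating \<open>Q L\<close> leaves
  \<open>3 (L Q - Q) = 0\<close>.\<close>

lemma L_Q: "triple e e (triple e x e) = triple e x e"
  and Q_L: "triple e (triple e e x) e = triple e x e"
proof -
  have a: "triple e e (triple e x e) = 2 *\<^sub>R triple e x e - triple e (triple e e x) e"
    using triple_jordan[of e e e x e] e by (simp add: scaleR_2 algebra_simps)
  have b: "triple e x e = 2 *\<^sub>R triple e e (triple e x e) - triple e (triple e e x) e"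
    using triple_jordan[of e x e e e] e triple_symmetric[of x e e]
      triple_symmetric[of "triple e x e" e e]
    by (simp add: scaleR_2 algebra_simps)
  have "3 *\<^sub>R (triple e e (triple e x e) - triple e x e) =
    (2 *\<^sub>R triple e e (triple e x e) - triple e (triple e e x) e - triple e x e) +
    (triple e e (triple e x e) - 2 *\<^sub>R triple e x e + triple e (triple e e x) e)"
    by (simp add: scaleR_left_distrib[of 1 2, simplified] algebra_simps scaleR_2)
  also have "\<dots> = 0" using a b by simp
  finally show 1: "triple e e (triple e x e) = triple e x e" by simp
  show "triple e (triple e e x) e = triple e x e"
    using a unfolding 1 by (simp add: scaleR_2 algebra_simps)
qed

text \<open>By \<open>L_Q\<close>, the operator \<open>L - 1\<close> kills
  \<open>Q^2 = 2 L^2 - L\<close>. The resulting cubic has the roots 0, 1/2 and 1, the Peirce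
  eigenvalues.\<close>

lemma L_cubic:
  "2 *\<^sub>R triple e e (triple e e (triple e e x)) =
    3 *\<^sub>R triple e e (triple e e x) - triple e e x"
  using L_Q[of "triple e x e"] unfolding Q_squared
  by (simp add: triple_linear_simps algebra_simps scaleR_left_distrib[of 1 2, simplified] scaleR_2)

text \<open>Any eigenvalue on a nonzero vector is a root of the cubic. This kills products whose
  weight by \<open>peirce_weight\<close> is a forbidden number such as 2 or 3/2.\<close>

lemma peirce_weight_eq_0:
  assumes "triple e e x = r *\<^sub>R x" "r \<noteq> 0" "r \<noteq> 1/2" "r \<noteq> 1"
  shows "x = 0"
proof -
  have "2 *\<^sub>R (r * (r * r)) *\<^sub>R x = 3 *\<^sub>R (r * r) *\<^sub>R x - r *\<^sub>R x"
    using L_cubic[of x] assms(1) by (simp add: triple_linear_simps mult.assoc)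
  hence "(2 * (r * (r * r)) - 3 * (r * r) + r) *\<^sub>R x = 0"
    by (simp add: scaleR_left_distrib scaleR_left_diff_distrib)
  moreover have "2 * (r * (r * r)) - 3 * (r * r) + r = r * (2 * r - 1) * (r - 1)"
    by (simp add: algebra_simps)
  ultimately show ?thesis using assms by auto
qed

text \<open>Peirce calculus: by the Jordan identity \<open>L(e,e)\<close> acts on a product like a
  derivation, with the opposite sign in the middle variable.\<close>

lemma peirce_weight:
  assumes "triple e e a = i *\<^sub>R a" "triple e e b = j *\<^sub>R b" "triple e e c = k *\<^sub>R c"
  shows "triple e e (triple a b c) = (i - j + k) *\<^sub>R triple a b c"
  using triple_jordan[of e e a b c] assms
  by (simp add: triple_linear_simps scaleR_left_distrib scaleR_left_diff_distrib)

end

text \<open>The part of the cube of \<open>e + s w\<close> that is linear in \<open>s\<close> is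
  \<open>2 {e,e,w} + {e,w,e}\<close>, and the second term vanishes. The rest is of order
  \<open>s^2\<close>, and the norm of the cube is the cube of the norm.\<close>

lemma cube_near_tripotent:
  assumes e: "triple e e e = e" "norm e = 1"
  shows "\<exists>C\<ge>0. \<forall>w s. triple e w e = 0 \<longrightarrow> norm w \<le> B \<longrightarrow> 0 \<le> s \<longrightarrow> s \<le> 1 \<longrightarrow>
    norm (e + s *\<^sub>R w) ^ 3 \<le> norm (e + s *\<^sub>R (2 *\<^sub>R triple e e w)) + C * s\<^sup>2"
proof -
  obtain K where K: "K \<ge> 0" "\<And>a b c. norm (triple a b c) \<le> K * norm a * norm b * norm c"
    using triple_bounded by blast
  \<comment> \<open>The summands bound the quadratic and the cubic terms in \<open>w\<close>. The
    absolute value keeps \<open>C\<close> nonnegative also for negative \<open>B\<close>, where the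
    estimate is vacuous.\<close>
  define C where "C = 3 * (K * B\<^sup>2) + K * \<bar>B\<bar> ^ 3"
  have "norm (e + s *\<^sub>R w) ^ 3 \<le> norm (e + s *\<^sub>R (2 *\<^sub>R triple e e w)) + C * s\<^sup>2"
    if w: "triple e w e = 0" "norm w \<le> B" and s: "0 \<le> s" "s \<le> 1" for w s
  proof -
    let ?a = "e + s *\<^sub>R w"
    let ?r = "2 *\<^sub>R triple e w w + triple w e w"
    have cube: "triple ?a ?a ?a =
        (e + s *\<^sub>R (2 *\<^sub>R triple e e w)) + (s\<^sup>2 *\<^sub>R ?r + s ^ 3 *\<^sub>R triple w w w)"
      using e(1) w(1) triple_symmetric[of w e e] triple_symmetric[of w w e]
      by (simp add: triple_linear_simps algebra_simps power2_eq_square power3_eq_cube scaleR_2)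
    have "0 \<le> B" using w(2) norm_ge_zero[of w] by linarith
    have B: "norm w ^ 2 \<le> B\<^sup>2" "norm w ^ 3 \<le> \<bar>B\<bar> ^ 3"
      by (intro power_mono; use w(2) \<open>0 \<le> B\<close> in auto)+
    have "norm ?r \<le> 2 * norm (triple e w w) + norm (triple w e w)"
      by (rule order_trans[OF norm_triangle_ineq]) simp
    also have "\<dots> \<le> 3 * (K * (norm w)\<^sup>2)"
      using K(2)[of e w w] K(2)[of w e w] e(2) by (simp add: power2_eq_square mult_ac)
    also have "\<dots> \<le> 3 * (K * B\<^sup>2)" using K(1) B by (simp add: mult_left_mono)
    finally have r: "norm ?r \<le> 3 * (K * B\<^sup>2)" .
    have "norm (triple w w w) \<le> K * norm w ^ 3"
      using K(2)[of w w w] by (simp add: power3_eq_cube mult_ac)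
    also have "\<dots> \<le> K * \<bar>B\<bar> ^ 3" using K(1) B by (simp add: mult_left_mono)
    finally have www: "norm (triple w w w) \<le> K * \<bar>B\<bar> ^ 3" .
    have "s ^ 3 \<le> s\<^sup>2" using s by (simp add: power_decreasing)
    have "norm (s\<^sup>2 *\<^sub>R ?r + s ^ 3 *\<^sub>R triple w w w) \<le> s\<^sup>2 * norm ?r + s ^ 3 * norm (triple w w w)"
      using s by (intro order_trans[OF norm_triangle_ineq]) simp
    also have "\<dots> \<le> s\<^sup>2 * (3 * (K * B\<^sup>2)) + s\<^sup>2 * (K * \<bar>B\<bar> ^ 3)"
      using s r www K(1) \<open>s ^ 3 \<le> s\<^sup>2\<close> by (intro add_mono mult_mono) auto
    finally have rest: "norm (s\<^sup>2 *\<^sub>R ?r + s ^ 3 *\<^sub>R triple w w w) \<le> C * s\<^sup>2"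
      by (simp add: C_def algebra_simps)
    have "norm ?a ^ 3 = norm (triple ?a ?a ?a)" by (simp only: norm_triple)
    also have "\<dots> \<le> norm (e + s *\<^sub>R (2 *\<^sub>R triple e e w)) +
        norm (s\<^sup>2 *\<^sub>R ?r + s ^ 3 *\<^sub>R triple w w w)"
      unfolding cube by (rule norm_triangle_ineq)
    finally show ?thesis using rest by linarith
  qed
  moreover have "C \<ge> 0" using K(1) by (simp add: C_def)
  ultimately show ?thesis by blast
qed

text \<open>Cubing shrinks first-order perturbations in \<open>E\<^sub>0(e) + E\<^sub>1(e)\<close>: it kills the part in \<open>E\<^sub>0(e)\<close>
  and fixes the part in \<open>E\<^sub>1(e)\<close>, while it triples the logarithm of the norm.\<close>

lemma norm_near_tripotent:
  assumes e: "triple e e e = e" "norm e = 1"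
  shows "\<exists>C\<ge>0. \<forall>w s. triple e w e = 0 \<longrightarrow> norm w \<le> 1 \<longrightarrow> 0 \<le> s \<longrightarrow> s \<le> 1 \<longrightarrow>
    norm (e + s *\<^sub>R w) \<le> 1 + C * s\<^sup>2"
proof -
  obtain K where K: "K \<ge> 0" "\<And>a b c. norm (triple a b c) \<le> K * norm a * norm b * norm c"
    using triple_bounded by blast
  obtain C where C: "C \<ge> 0" "\<And>w s. triple e w e = 0 \<Longrightarrow> norm w \<le> 1 \<Longrightarrow> 0 \<le> s \<Longrightarrow> s \<le> 1 \<Longrightarrow>
      norm (e + s *\<^sub>R w) ^ 3 \<le> norm (e + s *\<^sub>R (2 *\<^sub>R triple e e w)) + C * s\<^sup>2"
    using cube_near_tripotent[OF e, of 1] by blast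
  \<comment> \<open>The bound \<open>2 * K\<close> is the one available for \<open>2 {e,e,w}\<close>
    when \<open>w\<close> lies in the unit ball.\<close>
  obtain D where D: "D \<ge> 0" "\<And>w s. triple e w e = 0 \<Longrightarrow> norm w \<le> 2 * K \<Longrightarrow> 0 \<le> s \<Longrightarrow> s \<le> 1 \<Longrightarrow>
      norm (e + s *\<^sub>R w) ^ 3 \<le> norm (e + s *\<^sub>R (2 *\<^sub>R triple e e w)) + D * s\<^sup>2"
    using cube_near_tripotent[OF e, of "2 * K"] by blast
  have le: "n \<le> 1 + D'" if "n ^ 3 \<le> n + D'" "0 \<le> D'" for n D' :: real
  proof (rule ccontr)
    assume "\<not> n \<le> 1 + D'"
    hence n: "n > 1" "n - 1 > D'" using that(2) by linarith+
    have "0 \<le> (n - 1) * (n * n + (n - 1))"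
      using n(1) by (intro mult_nonneg_nonneg add_nonneg_nonneg) simp_all
    also have "\<dots> = n ^ 3 - (n + (n - 1))" by (simp add: algebra_simps power3_eq_cube)
    finally have "n + (n - 1) \<le> n ^ 3" by (simp only: diff_ge_0_iff_ge)
    thus False using that(1) n(2) by linarith
  qed
  have le': "n \<le> 1 + D'" if "n ^ 3 \<le> 1 + D'" "0 \<le> D'" for n D' :: real
  proof (cases "n \<ge> 1")
    case True
    hence "n ^ 1 \<le> n ^ 3" by (intro power_increasing) auto
    thus ?thesis using that by simp
  qed (use that in auto)
  have "norm (e + s *\<^sub>R w) \<le> 1 + (C + D) * s\<^sup>2"
    if w: "triple e w e = 0" "norm w \<le> 1" and s: "0 \<le> s" "s \<le> 1" for w s
  proof -
    \<comment> \<open>This is the component of \<open>w\<close> in \<open>E_1(e)\<close>. Cubing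
      fixes \<open>e + s v\<close> to first order, so its norm \<open>n\<close> satisfies
      \<open>n^3 \<le> n + D s^2\<close>, which bounds \<open>n\<close> by \<open>le\<close>; a
      second cubing estimate passes from \<open>v\<close> back to \<open>w\<close>.\<close>
    define v where "v = 2 *\<^sub>R triple e e w"
    have "norm (triple e e w) \<le> K * norm w" using K(2)[of e e w] e by simp
    also have "\<dots> \<le> K" using K(1) w(2) by (simp add: mult_left_le)
    finally have v: "norm v \<le> 2 * K" by (simp add: v_def)
    have "triple e v e = 0"
      using w(1) Q_L[OF e(1), of w] by (simp add: v_def triple_linear_simps)
    moreover have "2 *\<^sub>R triple e e v = v"
      using Q_squared[OF e(1), of w] w(1) by (simp add: v_def triple_linear_simps)
    ultimately have "norm (e + s *\<^sub>R v) \<le> 1 + D * s\<^sup>2"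
      using D(2)[of v s] v s D(1) by (intro le) auto
    moreover have "norm (e + s *\<^sub>R w) ^ 3 \<le> norm (e + s *\<^sub>R v) + C * s\<^sup>2"
      using C(2)[of w s] w s by (simp add: v_def)
    ultimately have "norm (e + s *\<^sub>R w) ^ 3 \<le> 1 + (C * s\<^sup>2 + D * s\<^sup>2)"
      by linarith
    hence "norm (e + s *\<^sub>R w) \<le> 1 + (C * s\<^sup>2 + D * s\<^sup>2)"
      by (rule le') (use C(1) D(1) in simp)
    thus ?thesis by (simp add: algebra_simps)
  qed
  thus ?thesis using C(1) D(1) by (intro exI[of _ "C + D"]) auto
qed

lemma tripotent_norm_1:
  assumes "triple e e e = e" "e \<noteq> 0"
  shows "norm e = 1"
proof -
  have "norm e = norm e ^ 3" using norm_triple[of e] assms(1) by simp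
  hence "norm e * (norm e ^ 2 - 1) = 0" by (simp add: algebra_simps power2_eq_square power3_eq_cube)
  hence "norm e ^ 2 = 1" using assms(2) by simp
  thus ?thesis by (simp add: power2_eq_1_iff) (use norm_ge_zero[of e] in linarith)
qed

section \<open>Minimal tripotents and Peirce projections in terms of \<open>L(e,e)\<close>\<close>

lemma peirce_space_iff: "x \<in> peirce_space triple k e \<longleftrightarrow> triple e e x = (real k / 2) *\<^sub>R x"
  by (simp add: peirce_space_def scaleR_eq_scaleC)

lemma min_tripotents_iff:
  "e \<in> min_tripotents triple \<longleftrightarrow>
    triple e e e = e \<and> e \<noteq> 0 \<and> (\<forall>x. triple e e x = x \<longrightarrow> (\<exists>c. x = c *\<^sub>C e))"
  (is "?l \<longleftrightarrow> ?r")
proof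
  assume l: ?l
  have e: "e \<noteq> 0"
  proof
    assume "e = 0"
    hence "range (\<lambda>c. c *\<^sub>C e) = {0}" by auto
    thus False using l by (simp add: min_tripotents_def)
  qed
  have "\<exists>c. x = c *\<^sub>C e" if "triple e e x = x" for x
  proof -
    have "x \<in> peirce_space triple 2 e" using that by (simp add: peirce_space_iff)
    thus ?thesis using l by (auto simp: min_tripotents_def)
  qed
  thus ?r using l e by (auto simp: min_tripotents_def tripotent_def)
next
  assume r: ?r
  hence "peirce_space triple 2 e = range (\<lambda>c. c *\<^sub>C e)"
    by (auto simp: peirce_space_iff triple_scaleC_right)
  moreover have "e \<in> peirce_space triple 2 e" using r by (simp add: peirce_space_iff)
  ultimately show ?l using r by (auto simp: min_tripotents_def tripotent_def)
qed

lemma peirce_proj_2: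
  assumes e: "triple e e e = e"
  shows "peirce_proj triple 2 e x = triple e (triple e x e) e"
proof -
  let ?L = "triple e e"
  \<comment> \<open>The Lagrange polynomials for the nodes 0, 1/2 and 1, evaluated at
    \<open>L(e,e)\<close>; by \<open>L_cubic\<close> they yield eigenvectors.\<close>
  define z where "z = (\<lambda>k::nat. if k = 0 then x - 3 *\<^sub>R ?L x + 2 *\<^sub>R ?L (?L x)
    else if k = 1 then 4 *\<^sub>R ?L x - 4 *\<^sub>R ?L (?L x) else triple e (triple e x e) e)"
  note cub = L_cubic[OF e, of x]
  have set2: "{..2::nat} = {0, 1, 2}" by auto
  have all2: "(\<forall>j\<le>2::nat. Q j) \<longleftrightarrow> Q 0 \<and> Q 1 \<and> Q 2" for Q
    by (metis One_nat_def Suc_1 le_SucE le_zero_eq order_refl zero_le one_le_numeral)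
  have lin: "?L (a - b) = ?L a - ?L b" "?L (a + b) = ?L a + ?L b" "?L (r *\<^sub>R a) = r *\<^sub>R ?L a" for a b r
    by (simp_all add: triple_linear_simps)
  have z2: "z 2 = 2 *\<^sub>R ?L (?L x) - ?L x" using Q_squared[OF e, of x] by (simp add: z_def)
  have sum: "x = (\<Sum>j\<le>2. z j)"
    unfolding set2 using z2 by (simp add: z_def scaleR_left_distrib[of 1 3, simplified]
        scaleR_left_distrib[of 1 2, simplified] scaleR_2)
  have "?L (z 0) = ?L x - 3 *\<^sub>R ?L (?L x) + 2 *\<^sub>R ?L (?L (?L x))"
    by (simp add: z_def lin)
  hence p0: "?L (z 0) = 0" unfolding cub by simp
  have "?L (z 1) = 4 *\<^sub>R ?L (?L x) - 2 *\<^sub>R (2 *\<^sub>R ?L (?L (?L x)))"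
    by (simp add: z_def lin)
  also have "\<dots> = (1/2) *\<^sub>R z 1" unfolding cub
    by (simp add: z_def scaleR_right_diff_distrib scaleR_left_distrib[of 2 4, simplified])
  finally have p1: "?L (z 1) = (1/2) *\<^sub>R z 1" .
  have p2: "?L (z 2) = z 2" by (simp add: z_def L_Q[OF e])
  show ?thesis unfolding peirce_proj_def
  proof (rule the_equality)
    show "\<exists>z. (\<forall>j\<le>2. z j \<in> peirce_space triple j e) \<and> x = (\<Sum>j\<le>2. z j) \<and>
      triple e (triple e x e) e = z 2"
      using p0 p1 p2 sum by (intro exI[of _ z]) (simp add: all2 peirce_space_iff z_def)
  next
    fix y assume "\<exists>z. (\<forall>j\<le>2. z j \<in> peirce_space triple j e) \<and> x = (\<Sum>j\<le>2. z j) \<and> y = z 2"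
    then obtain z :: "nat \<Rightarrow> 'a" where "\<forall>j\<le>2. z j \<in> peirce_space triple j e"
      and x: "x = (\<Sum>j\<le>2. z j)" and y: "y = z 2"
      by blast
    hence z: "?L (z 0) = 0" "?L (z 1) = (1/2) *\<^sub>R z 1" "?L (z 2) = z 2" "x = z 0 + (z 1 + z 2)" "y = z 2"
      unfolding all2 set2 by (simp_all add: peirce_space_iff)
    \<comment> \<open>For any Peirce decomposition, \<open>2 L^2 x - L x\<close> cancels the
      component in \<open>E_1(e)\<close> and leaves \<open>z 2\<close>, which gives
      uniqueness.\<close>
    have "?L x = (1/2) *\<^sub>R z 1 + z 2" using z by (simp add: lin)
    moreover from this have "?L (?L x) = (1/4) *\<^sub>R z 1 + z 2" using z by (simp add: lin)
    ultimately show "y = triple e (triple e x e) e"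
      using Q_squared[OF e, of x] z(5)
      by (simp add: scaleR_right_distrib scaleR_2)
  qed
qed

subsection \<open>The support functional of a minimal tripotent\<close>

text \<open>This is \<phi>_e. The conjugate-linear map \<open>x \<mapsto> {e,x,e}\<close> is applied
  twice, so the coefficient is complex-linear in \<open>x\<close>.\<close>

definition peirce_coord :: "'a \<Rightarrow> 'a \<Rightarrow> complex" where
  "peirce_coord e x = (THE c. triple e (triple e x e) e = c *\<^sub>C e)"

lemma min_tripotentD:
  assumes "e \<in> min_tripotents triple"
  shows "triple e e e = e" "e \<noteq> 0" "norm e = 1"
    "triple e e x = x \<Longrightarrow> \<exists>c. x = c *\<^sub>C e"
proof -
  show e: "triple e e e = e" "e \<noteq> 0" using assms unfolding min_tripotents_iff by simp_all
  show "norm e = 1" by (rule tripotent_norm_1[OF e])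
  show "\<exists>c. x = c *\<^sub>C e" if "triple e e x = x"
    using assms that unfolding min_tripotents_iff by blast
qed

context
  fixes e
  assumes e: "e \<in> min_tripotents triple"
begin

lemma peirce_coord_unique: "triple e (triple e x e) e = c *\<^sub>C e \<Longrightarrow> peirce_coord e x = c"
  unfolding peirce_coord_def using min_tripotentD(2)[OF e]
  by (intro the_equality) (auto simp: complex_vector.scale_cancel_right)

lemma peirce_coord: "triple e (triple e x e) e = peirce_coord e x *\<^sub>C e"
proof -
  obtain c where "triple e (triple e x e) e = c *\<^sub>C e"
    using min_tripotentD(4)[OF e L_Q[OF min_tripotentD(1)[OF e], of "triple e x e"]] by blast
  thus ?thesis using peirce_coord_unique[of x c] by simp
qed

lemma peirce_coord_self: "peirce_coord e e = 1"
  using min_tripotentD(1)[OF e] by (intro peirce_coord_unique) simp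

lemma peirce_coord_add: "peirce_coord e (x + y) = peirce_coord e x + peirce_coord e y"
  by (intro peirce_coord_unique) (simp add: triple_linear_simps peirce_coord scaleC_add_left)

lemma peirce_coord_scaleC: "peirce_coord e (c *\<^sub>C x) = c * peirce_coord e x"
  by (intro peirce_coord_unique) (simp add: triple_scaleC_middle peirce_coord)

text \<open>By minimality \<open>{e,x,e}\<close> is some \<open>c e\<close>, and applying the map
  once more gives \<open>cnj c\<close> times \<open>e\<close>; both coefficients vanish
  together.\<close>

lemma peirce_coord_eq_0_iff: "peirce_coord e x = 0 \<longleftrightarrow> triple e x e = 0"
proof
  assume 0: "peirce_coord e x = 0"
  obtain c where c: "triple e x e = c *\<^sub>C e"
    using min_tripotentD(4)[OF e L_Q[OF min_tripotentD(1)[OF e], of x]] by blast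
  have "cnj c *\<^sub>C e = 0"
    using peirce_coord[of x] 0 by (simp add: c triple_scaleC_middle min_tripotentD(1)[OF e])
  thus "triple e x e = 0" using min_tripotentD(2)[OF e] by (simp add: c)
next
  assume "triple e x e = 0"
  thus "peirce_coord e x = 0" by (intro peirce_coord_unique) (simp add: triple_linear_simps)
qed

lemma peirce_coord_bounded: "\<exists>K\<ge>0. \<forall>x. cmod (peirce_coord e x) \<le> K * norm x"
proof -
  obtain K where K: "K \<ge> 0" "\<And>a b c. norm (triple a b c) \<le> K * norm a * norm b * norm c"
    using triple_bounded by blast
  have "cmod (peirce_coord e x) \<le> K * K * norm x" for x
  proof -
    have n: "norm e = 1" using min_tripotentD(3)[OF e] .
    have "cmod (peirce_coord e x) = norm (triple e (triple e x e) e)"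
      by (simp add: peirce_coord norm_scaleC n)
    also have "\<dots> \<le> K * norm (triple e x e)" using K(2)[of e "triple e x e" e] n by simp
    also have "\<dots> \<le> K * (K * norm x)" using K(1) K(2)[of e x e] n by (intro mult_left_mono) auto
    finally show ?thesis by (simp add: mult_ac)
  qed
  thus ?thesis using K(1) by (intro exI[of _ "K * K"]) auto
qed

lemma bounded_linear_peirce_coord: "bounded_linear (peirce_coord e)"
proof -
  obtain K where "\<And>x. cmod (peirce_coord e x) \<le> K * norm x"
    using peirce_coord_bounded by blast
  thus ?thesis
    by (intro bounded_linear_intro[where K = K])
      (auto simp: peirce_coord_add peirce_coord_scaleC scaleR_eq_scaleC scaleR_conv_of_real mult_ac)
qed

text \<open>A quantitative form of the statement that the norm is Frechet differentiable at \<open>e\<close>.\<close>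

lemma functional_near_peirce_coord:
  "\<exists>C\<ge>0. \<forall>(g :: 'a \<Rightarrow>\<^sub>L complex) \<epsilon> x. (\<forall>c x. blinfun_apply g (c *\<^sub>C x) = c * blinfun_apply g x) \<longrightarrow> norm g \<le> 1 \<longrightarrow>
    0 < \<epsilon> \<longrightarrow> \<epsilon> \<le> 1 \<longrightarrow> cmod (g e - 1) \<le> \<epsilon> \<longrightarrow>
    cmod (g x - peirce_coord e x) \<le> C * sqrt \<epsilon> * norm x"
proof -
  note ne = min_tripotentD(3)[OF e]
  obtain K where K: "K \<ge> 0" "\<And>x. cmod (peirce_coord e x) \<le> K * norm x"
    using peirce_coord_bounded by blast
  obtain D where D: "D \<ge> 0" "\<And>w s. triple e w e = 0 \<Longrightarrow> norm w \<le> 1 \<Longrightarrow> 0 \<le> s \<Longrightarrow> s \<le> 1 \<Longrightarrow>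
      norm (e + s *\<^sub>R w) \<le> 1 + D * s\<^sup>2"
    using norm_near_tripotent[OF min_tripotentD(1)[OF e] ne] by blast
  have "cmod (g x - peirce_coord e x) \<le> ((1 + D) * (1 + K) + K) * sqrt \<epsilon> * norm x"
    if hom: "\<And>c x. g (c *\<^sub>C x) = c * g x" and ng: "norm g \<le> 1"
      and \<epsilon>: "0 < \<epsilon>" "\<epsilon> \<le> 1" and ge: "cmod (g e - 1) \<le> \<epsilon>"
    for g :: "'a \<Rightarrow>\<^sub>L complex" and \<epsilon> x
  proof -
    \<comment> \<open>Perturbing \<open>e\<close> by a vector of size \<open>s\<close> bounds
      \<open>g\<close> on the kernel by \<open>\<epsilon> / s + D s\<close>; this choice makes both
      terms of order \<open>s\<close>.\<close>
    define s where "s = sqrt \<epsilon>"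
    have s: "0 < s" "s \<le> 1" "s\<^sup>2 = \<epsilon>" "\<epsilon> \<le> s"
      using \<epsilon> by (auto simp: s_def real_le_rsqrt power2_eq_square mult_left_le)
    have g_le: "cmod (g z) \<le> norm z" for z
      using norm_blinfun[of g z] ng mult_right_mono[OF ng norm_ge_zero[of z]] by linarith
    have unit: "cmod (g w) \<le> (1 + D) * s" if w: "triple e w e = 0" "norm w \<le> 1" for w
    proof (cases "g w = 0")
      case False
      \<comment> \<open>A unimodular factor that makes \<open>g (c w)\<close> real and positive, so
        that it adds to \<open>g e\<close>, which is close to 1.\<close>
      define c where "c = cnj (g w) / of_real (cmod (g w))"
      have "cmod c = 1" using False by (simp add: c_def norm_divide)
      have "c * g w = of_real (cmod (g w))"
        using False complex_norm_square[of "g w"]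
        by (simp add: c_def field_simps power2_eq_square)
      hence g: "g (e + s *\<^sub>R (c *\<^sub>C w)) = g e + of_real (s * cmod (g w))"
        by (simp add: blinfun.bilinear_simps hom scaleR_conv_of_real)
      have "norm (e + s *\<^sub>R (c *\<^sub>C w)) \<le> 1 + D * s\<^sup>2"
        using w s \<open>cmod c = 1\<close> by (intro D(2)) (auto simp: triple_scaleC_middle norm_scaleC)
      hence "Re (g e) + s * cmod (g w) \<le> 1 + D * s\<^sup>2"
        using g_le[of "e + s *\<^sub>R (c *\<^sub>C w)"] complex_Re_le_cmod[of "g (e + s *\<^sub>R (c *\<^sub>C w))"]
        unfolding g by simp
      moreover have "1 - Re (g e) \<le> \<epsilon>"
        using abs_Re_le_cmod[of "g e - 1"] ge by simp
      ultimately have "s * cmod (g w) \<le> s * ((1 + D) * s)"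
        using s(3) by (simp add: algebra_simps power2_eq_square)
      thus ?thesis using s(1) by simp
    qed (use D s in simp)
    have ker: "cmod (g w) \<le> (1 + D) * s * norm w" if w: "triple e w e = 0" for w
    proof (cases "w = 0")
      case False
      have "cmod (g ((1 / norm w) *\<^sub>R w)) \<le> (1 + D) * s"
        using w False by (intro unit) (auto simp: triple_linear_simps)
      thus ?thesis using False by (simp add: blinfun.bilinear_simps field_simps)
    qed simp
    \<comment> \<open>Splitting off the component of \<open>x\<close> along \<open>e\<close> leaves
      a vector in the kernel of \<phi>_e, where \<open>ker\<close> applies.\<close>
    define w where "w = x - peirce_coord e x *\<^sub>C e"
    have "peirce_coord e (w + peirce_coord e x *\<^sub>C e) = peirce_coord e x" by (simp add: w_def)
    hence "triple e w e = 0"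
      by (simp add: peirce_coord_add peirce_coord_scaleC peirce_coord_self flip: peirce_coord_eq_0_iff)
    hence "cmod (g w) \<le> (1 + D) * s * norm w" by (rule ker)
    also have "norm w \<le> norm x + norm (peirce_coord e x *\<^sub>C e)"
      unfolding w_def by (rule norm_triangle_ineq4)
    also have "\<dots> \<le> (1 + K) * norm x" using K(2)[of x] ne by (simp add: norm_scaleC algebra_simps)
    finally have gw: "cmod (g w) \<le> (1 + D) * s * ((1 + K) * norm x)"
      using D s by (simp add: mult_left_mono)
    have "x = w + peirce_coord e x *\<^sub>C e" by (simp add: w_def)
    hence "g x = g w + peirce_coord e x * g e" by (metis blinfun.add_right hom)
    hence "g x - peirce_coord e x = g w + peirce_coord e x * (g e - 1)"
      by (simp add: algebra_simps)
    hence "cmod (g x - peirce_coord e x) \<le> cmod (g w) + cmod (peirce_coord e x) * cmod (g e - 1)"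
      by (metis norm_mult norm_triangle_ineq)
    also have "cmod (peirce_coord e x) * cmod (g e - 1) \<le> K * norm x * s"
      using K ge s by (intro mult_mono) auto
    finally show ?thesis using gw unfolding s_def[symmetric] by (simp add: algebra_simps)
  qed
  thus ?thesis using D(1) K(1) by (intro exI[of _ "(1 + D) * (1 + K) + K"]) auto
qed

text \<open>As \<open>g e\<close> is exactly 1, the preceding estimate holds for every small
  \<epsilon>, and its right side tends to 0.\<close>

lemma functional_eq_peirce_coord:
  fixes g :: "'a \<Rightarrow>\<^sub>L complex"
  assumes "\<And>c x. g (c *\<^sub>C x) = c * g x" "norm g \<le> 1" "g e = 1"
  shows "g x = peirce_coord e x"
proof -
  obtain C where C: "C \<ge> 0" "\<And>(g :: 'a \<Rightarrow>\<^sub>L complex) \<epsilon> x. (\<And>c x. blinfun_apply g (c *\<^sub>C x) = c * blinfun_apply g x) \<Longrightarrow> norm g \<le> 1 \<Longrightarrow>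
    0 < \<epsilon> \<Longrightarrow> \<epsilon> \<le> 1 \<Longrightarrow> cmod (g e - 1) \<le> \<epsilon> \<Longrightarrow> cmod (g x - peirce_coord e x) \<le> C * sqrt \<epsilon> * norm x"
    using functional_near_peirce_coord by blast
  have le: "cmod (g x - peirce_coord e x) \<le> C * norm x * s" if "0 < s" "s \<le> 1" for s
    using C(2)[of g "s\<^sup>2" x] assms that by (simp add: power_le_one mult_ac)
  have "(\<lambda>n. C * norm x * inverse (real (Suc n))) \<longlonglongrightarrow> C * norm x * 0"
    by (intro tendsto_intros LIMSEQ_inverse_real_of_nat)
  moreover have "cmod (g x - peirce_coord e x) \<le> C * norm x * inverse (real (Suc n))" for n
    by (rule le) (simp_all add: field_simps)
  ultimately have "cmod (g x - peirce_coord e x) \<le> C * norm x * 0"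
    by (intro LIMSEQ_le_const[of "\<lambda>n. C * norm x * inverse (real (Suc n))"]) blast+
  thus ?thesis by simp
qed

end

end

section \<open>The support functional as an extreme point of the unit ball of the predual\<close>

context jbw_triple
begin

lemma predual_scale: "f \<in> predual \<Longrightarrow> blinfun_mult_right c o\<^sub>L f \<in> predual"
  and predual_homogeneous: "f \<in> predual \<Longrightarrow> f (c *\<^sub>C x) = c * f x"
  and predual_closed: "closed predual"
  and zero_in_predual: "0 \<in> predual"
  and predual_norm: "norm x = (SUP f\<in>predual \<inter> cball 0 1. cmod (blinfun_apply f x))"
  using is_predual unfolding is_predual_def by blast+

text \<open>Almost norming functionals in the predual converge to \<open>\<phi>\<^sub>e\<close> in norm, since the norm is
  smooth at \<open>e\<close>. This replaces the weak* continuity of the triple product.\<close>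

lemma peirce_coord_in_predual:
  assumes e: "e \<in> min_tripotents triple"
  shows "Blinfun (peirce_coord e) \<in> predual \<inter> cball 0 1"
proof -
  let ?F = "Blinfun (peirce_coord e)"
  have F: "blinfun_apply ?F x = peirce_coord e x" for x
    using bounded_linear_peirce_coord[OF e] by (simp add: bounded_linear_Blinfun_apply)
  obtain C where C: "C \<ge> 0" "\<And>(g :: 'a \<Rightarrow>\<^sub>L complex) \<epsilon> x. (\<And>c x. blinfun_apply g (c *\<^sub>C x) = c * blinfun_apply g x) \<Longrightarrow> norm g \<le> 1 \<Longrightarrow>
    0 < \<epsilon> \<Longrightarrow> \<epsilon> \<le> 1 \<Longrightarrow> cmod (g e - 1) \<le> \<epsilon> \<Longrightarrow> cmod (g x - peirce_coord e x) \<le> C * sqrt \<epsilon> * norm x"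
    using functional_near_peirce_coord[OF e] by blast
  have "\<exists>f\<in>predual \<inter> cball 0 1. dist f ?F < d" if "d > 0" for d
  proof -
    \<comment> \<open>Small enough for \<open>C * s < d\<close>; the 1 added to \<open>C\<close>
      avoids a zero denominator. The functional \<open>f\<close> below is chosen almost norming with
      defect \<open>s^2\<close>, so the estimate is used with
      \<open>\<epsilon> = s^2\<close>.\<close>
    define s where "s = min 1 (d / (2 * (C + 1)))"
    have s: "0 < s" "s \<le> 1" "C * s < d"
    proof -
      show "0 < s" "s \<le> 1" using \<open>d > 0\<close> C(1) by (auto simp: s_def)
      have "C * s \<le> C * (d / (2 * (C + 1)))" using C(1) by (intro mult_left_mono) (auto simp: s_def)
      also have "\<dots> < d" using \<open>d > 0\<close> C(1) by (simp add: field_simps add_nonneg_pos)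
      finally show "C * s < d" .
    qed
    let ?S = "predual \<inter> cball 0 1"
    have norming: "1 - s\<^sup>2 < (SUP f\<in>?S. cmod (blinfun_apply f e))"
      using predual_norm[of e] min_tripotentD(3)[OF e] s(1) by simp
    have le: "cmod (blinfun_apply f e) \<le> 1" if "f \<in> ?S" for f
      using norm_blinfun[of f e] that min_tripotentD(3)[OF e] by simp
    hence bdd: "bdd_above ((\<lambda>f. cmod (blinfun_apply f e)) ` ?S)" by (intro bdd_aboveI[of _ 1]) auto
    have "?S \<noteq> {}" using zero_in_predual by auto
    then obtain f where f: "f \<in> ?S" "1 - s\<^sup>2 < cmod (f e)"
      using norming unfolding less_cSUP_iff[OF \<open>?S \<noteq> {}\<close> bdd] by blast
    have "s\<^sup>2 \<le> 1" using s by (simp add: power_le_one)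
    hence "f e \<noteq> 0" using f(2) by auto
    \<comment> \<open>Rotating \<open>f\<close> makes its value at \<open>e\<close> positive; the
      predual is a complex subspace, so the rotated functional stays in it.\<close>
    define c where "c = cnj (f e) / of_real (cmod (f e))"
    have nc: "cmod c = 1" using \<open>f e \<noteq> 0\<close> by (simp add: c_def norm_divide)
    have cf: "c * f e = of_real (cmod (f e))"
      using \<open>f e \<noteq> 0\<close> complex_norm_square[of "f e"]
      by (simp add: c_def field_simps power2_eq_square)
    let ?g = "blinfun_mult_right c o\<^sub>L f"
    have g: "?g \<in> predual" using f(1) predual_scale by blast
    have "norm (?g x) \<le> 1 * norm x" for x
      using norm_blinfun[of f x] f(1) mult_right_mono[of "norm f" 1 "norm x"] nc
      by (simp add: norm_mult)
    hence ng: "norm ?g \<le> 1" by (intro norm_blinfun_bound) auto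
    have "?g e - 1 = of_real (cmod (f e) - 1)" using cf by simp
    hence "cmod (?g e - 1) = \<bar>cmod (f e) - 1\<bar>" by (metis norm_of_real real_norm_def)
    also have "\<dots> \<le> s\<^sup>2" using f(2) le[OF f(1)] by simp
    finally have "cmod (?g x - peirce_coord e x) \<le> C * sqrt (s\<^sup>2) * norm x" for x
      using s \<open>s\<^sup>2 \<le> 1\<close> predual_homogeneous[OF g] ng by (intro C(2)) auto
    hence "norm (?g - ?F) \<le> C * s"
      using C(1) s by (intro norm_blinfun_bound) (auto simp: blinfun.bilinear_simps F)
    hence "dist ?g ?F < d" using s(3) by (simp add: dist_norm)
    thus ?thesis using g ng by (intro bexI[of _ ?g]) auto
  qed
  hence "?F \<in> closure (predual \<inter> cball 0 1)" by (simp add: closure_approachable)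
  moreover have "closed (predual \<inter> cball 0 1)" using predual_closed by (intro closed_Int) auto
  ultimately show ?thesis by simp
qed

text \<open>If \<phi>_e is a proper convex combination of \<open>a\<close> and \<open>b\<close> in
  the ball, the real parts at \<open>e\<close> are at most 1 and average to 1. Hence both values at
  \<open>e\<close> are 1, and smoothness of the norm identifies \<open>a\<close> and
  \<open>b\<close> with \<phi>_e.\<close>

lemma support_functional_eq:
  assumes e: "e \<in> min_tripotents triple"
  shows "support_functional triple predual e = Blinfun (peirce_coord e)"
proof -
  let ?F = "Blinfun (peirce_coord e)"
  have F: "blinfun_apply ?F x = peirce_coord e x" for x
    using bounded_linear_peirce_coord[OF e] by (simp add: bounded_linear_Blinfun_apply)
  have proj: "peirce_proj triple 2 e x = peirce_coord e x *\<^sub>C e" for x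
    using peirce_proj_2[OF min_tripotentD(1)[OF e]] peirce_coord[OF e] by simp
  have eqF: "g = ?F" if g: "g \<in> predual \<inter> cball 0 1" "g e = 1" for g
  proof (rule blinfun_eqI)
    fix x
    have "g \<in> predual" "norm g \<le> 1" using g(1) by auto
    thus "g x = ?F x" using functional_eq_peirce_coord[OF e predual_homogeneous _ g(2)] F by simp
  qed
  have "?F extreme_point_of (predual \<inter> cball 0 1)"
    unfolding extreme_point_of_def
  proof (intro conjI ballI notI)
    show "?F \<in> predual \<inter> cball 0 1" by (rule peirce_coord_in_predual[OF e])
    fix a b assume ab: "a \<in> predual \<inter> cball 0 1" "b \<in> predual \<inter> cball 0 1" "?F \<in> open_segment a b"
    then obtain u where u: "a \<noteq> b" "0 < u" "u < 1" "?F = (1 - u) *\<^sub>R a + u *\<^sub>R b"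
      by (auto simp: in_segment)
    have "?F e = 1" by (simp add: F peirce_coord_self[OF e])
    hence "Re ((1 - u) *\<^sub>R a e + u *\<^sub>R b e) = 1"
      unfolding u(4) by (simp add: blinfun.bilinear_simps)
    hence re: "(1 - u) * (1 - Re (a e)) + u * (1 - Re (b e)) = 0" by (simp add: algebra_simps)
    have le: "cmod (g e) \<le> 1" if "g \<in> predual \<inter> cball 0 1" for g
      using norm_blinfun[of g e] that min_tripotentD(3)[OF e] by simp
    have Re_le: "Re (a e) \<le> 1" "Re (b e) \<le> 1"
      using le[OF ab(1)] le[OF ab(2)] complex_Re_le_cmod[of "a e"] complex_Re_le_cmod[of "b e"] by linarith+
    have "(1 - u) * (1 - Re (a e)) = 0 \<and> u * (1 - Re (b e)) = 0"
      using re u Re_le by (intro add_nonneg_eq_0_iff[THEN iffD1]) auto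
    hence Re1: "Re (a e) = 1" "Re (b e) = 1" using u by auto
    have one: "z = 1" if "Re z = 1" "cmod z \<le> 1" for z
    proof -
      have "(Re z)\<^sup>2 + (Im z)\<^sup>2 \<le> 1" using that(2) by (simp add: cmod_def)
      hence "Im z = 0" using that(1) by simp
      thus ?thesis using that(1) by (simp add: complex_eq_iff)
    qed
    have "a = ?F" by (rule eqF[OF ab(1) one[OF Re1(1) le[OF ab(1)]]])
    moreover have "b = ?F" by (rule eqF[OF ab(2) one[OF Re1(2) le[OF ab(2)]]])
    ultimately show False using u(1) by simp
  qed
  moreover have "f = ?F" if "\<forall>x. peirce_proj triple 2 e x = f x *\<^sub>C e" for f :: "'a \<Rightarrow>\<^sub>L complex"
    using that min_tripotentD(2)[OF e]
    by (intro blinfun_eqI) (simp add: proj F complex_vector.scale_cancel_right)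
  ultimately show ?thesis
    unfolding support_functional_def by (intro the_equality) (auto simp: proj F)
qed

lemma TTP_eq:
  assumes "v \<in> min_tripotents triple"
  shows "TTP triple predual e v = peirce_coord v e"
  using bounded_linear_peirce_coord[OF assms]
  by (simp add: TTP_def support_functional_eq[OF assms] bounded_linear_Blinfun_apply)

end

subsection \<open>Null vectors in the Peirce space \<open>E\<^sub>1(e)\<close>\<close>

context jb_triple
begin

text \<open>An eigenvector prevents \<open>\<mu> - L(x,x)\<close> from having a left inverse, so
  \<mu> lies in the spectrum.\<close>

lemma eigenvalue_nonneg:
  assumes "triple x x w = \<mu> *\<^sub>C w" "w \<noteq> 0"
  shows "\<mu> \<in> \<real>\<^sub>\<ge>\<^sub>0"
proof -
  have "\<mu> \<in> operator_spectrum (triple x x)"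
    unfolding operator_spectrum_def
  proof (clarify)
    fix S assume "bounded_linear S" and S: "\<forall>y. S (\<mu> *\<^sub>C y - triple x x y) = y"
    hence "S 0 = 0" by (simp add: linear_simps)
    thus False using S[rule_format, of w] assms by simp
  qed
  thus ?thesis using spectrum_triple by blast
qed

lemma scaleC_scaleR: "c *\<^sub>C r *\<^sub>R (x::'a) = r *\<^sub>R c *\<^sub>C x"
  by (simp add: scaleR_eq_scaleC scaleC_scaleC mult.commute)

text \<open>The vector \<open>x\<close> spans with \<open>{x,x,x}\<close> a space that is invariant under \<open>L(x,x)\<close>, whose square is
  scalar there. Non-negativity of the spectrum makes \<open>x\<close> an eigenvector, hence a positive multiple of
  a tripotent \<open>v\<close>. Then \<open>{v,e,v}\<close> would have weight 2 for \<open>L(v,v)\<close>, so it vanishes.\<close>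

lemma peirce_1_null_eq_0:
  assumes e: "e \<in> min_tripotents triple"
    and x1: "triple e e x = (1/2) *\<^sub>R x" and null: "triple x x e = 0"
  shows "x = 0"
proof (rule ccontr)
  assume "x \<noteq> 0"
  note te = min_tripotentD(1)[OF e]
  have te1: "triple e e e = 1 *\<^sub>R e" using te by simp
  define u where "u = triple x e x"
  define z where "z = triple x x x"
  define q where "q = triple x z x"
  have "z \<noteq> 0" using \<open>x \<noteq> 0\<close> by (simp add: z_def triple_cube_eq_0_iff)
  have xee: "triple x e e = (1/2) *\<^sub>R x" and exx: "triple e x x = 0"
    using x1 null triple_symmetric by metis+
  have u0: "triple e e u = 0 *\<^sub>R u"
    using peirce_weight[OF te x1 te1 x1] by (simp add: u_def)
  \<comment> \<open>The weight is 1/2 - 0 + 1/2 = 1, so \<open>{x,u,x}\<close> lies in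
    \<open>E_2(e)\<close>, the line through \<open>e\<close>.\<close>
  have "triple e e (triple x u x) = triple x u x"
    using peirce_weight[OF te x1 u0 x1] by simp
  then obtain \<kappa> where \<kappa>: "triple x u x = \<kappa> *\<^sub>C e" using min_tripotentD(4)[OF e] by blast
  have "triple e x u + (1/2) *\<^sub>R z = 0"
    using jordan_identity[of x e e x x] by (simp add: exx xee triple_linear_simps z_def u_def)
  hence exu: "triple e x u = - (1/2) *\<^sub>R z" by (simp add: eq_neg_iff_add_eq_0)
  have uxe: "triple u x e = - (1/2) *\<^sub>R z" using exu triple_symmetric by metis
  have uux: "triple u u x = triple x u u" by (rule triple_symmetric)
  \<comment> \<open>The Jordan identity evaluates \<open>{x,u,u}\<close> in two ways, here and in
    \<open>w2\<close>. Eliminating it gives \<open>q = - \<kappa> x\<close>, so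
    \<open>L(x,x)\<close> squared sends \<open>x\<close> to \<open>- \<kappa> x\<close>.\<close>
  have w1: "triple x u u = \<kappa> *\<^sub>C x + (1/2) *\<^sub>R q"
  proof -
    have "triple x u u = triple x e (\<kappa> *\<^sub>C e) + triple (\<kappa> *\<^sub>C e) e x - triple x (triple u x e) x"
      using jordan_identity[of x u x e x] by (simp only: \<kappa> flip: u_def)
    also have "\<dots> = (1/2) *\<^sub>R \<kappa> *\<^sub>C x + (1/2) *\<^sub>R \<kappa> *\<^sub>C x + (1/2) *\<^sub>R q"
      by (simp add: uxe triple_linear_simps triple_scaleC_right triple_scaleC_left xee x1
          scaleC_scaleR q_def)
    also have "(1/2) *\<^sub>R \<kappa> *\<^sub>C x + (1/2) *\<^sub>R \<kappa> *\<^sub>C x = \<kappa> *\<^sub>C x" by (simp flip: scaleR_left_distrib)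
    finally show ?thesis .
  qed
  have w2: "2 *\<^sub>R triple x u u = (1/2) *\<^sub>R \<kappa> *\<^sub>C x - (1/2) *\<^sub>R q"
  proof -
    have "triple x e (\<kappa> *\<^sub>C e) = triple x u u + triple x u u - triple x (triple e x u) x"
      using jordan_identity[of x e x u x] by (simp only: \<kappa> uux flip: u_def)
    thus ?thesis
      by (simp add: exu triple_linear_simps triple_scaleC_right xee scaleC_scaleR scaleR_2
          flip: q_def)
  qed
  have "(3/2) *\<^sub>R (q + \<kappa> *\<^sub>C x) =
      2 *\<^sub>R (\<kappa> *\<^sub>C x + (1/2) *\<^sub>R q) - ((1/2) *\<^sub>R \<kappa> *\<^sub>C x - (1/2) *\<^sub>R q)"
    using scaleR_left_distrib[of 1 "1/2" q] scaleR_left_diff_distrib[of 2 "1/2" "\<kappa> *\<^sub>C x"]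
    by (simp add: scaleR_right_distrib)
  also have "\<dots> = 0" using w1 w2 by simp
  finally have "q = - (\<kappa> *\<^sub>C x)" by (simp add: eq_neg_iff_add_eq_0)
  hence xxz: "triple x x z = - (\<kappa> *\<^sub>C x)"
    using jordan_power5[of x] by (simp add: q_def z_def)
  have zxx: "triple z x x = - (\<kappa> *\<^sub>C x)" using xxz triple_symmetric by metis
  \<comment> \<open>Otherwise \<open>{x,z,z} = 0\<close>, and expanding \<open>{z,z,z}\<close> with
    \<open>z = {x,x,x}\<close> gives 0, against \<open>z \<noteq> 0\<close>.\<close>
  have "\<kappa> \<noteq> 0"
  proof
    assume 0: "\<kappa> = 0"
    have "triple x z z = 0"
      using jordan_identity[of x z x x x] \<open>q = - (\<kappa> *\<^sub>C x)\<close> 0 zxx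
      by (simp add: triple_linear_simps flip: z_def q_def)
    hence "triple z z x = 0" using triple_symmetric by metis
    hence "triple z z z = 0"
      using jordan_identity[of z z x x x] by (simp add: triple_linear_simps flip: z_def)
    thus False using \<open>z \<noteq> 0\<close> by (simp add: triple_cube_eq_0_iff)
  qed
  \<comment> \<open>With this root, \<open>z + \<mu> x\<close> and \<open>z - \<mu> x\<close> are
    eigenvectors of \<open>L(x,x)\<close> for \<open>\<mu>\<close> and \<open>- \<mu>\<close> unless
    they vanish. Not both numbers are nonnegative, so one of the vectors is 0.\<close>
  define \<mu> where "\<mu> = csqrt (- \<kappa>)"
  have \<mu>: "\<mu> * \<mu> = - \<kappa>" using power2_csqrt[of "- \<kappa>"] by (simp add: \<mu>_def power2_eq_square)
  have "\<mu> \<noteq> 0" using \<mu> \<open>\<kappa> \<noteq> 0\<close> by auto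
  have plus: "triple x x (z + \<mu> *\<^sub>C x) = \<mu> *\<^sub>C (z + \<mu> *\<^sub>C x)"
    by (simp add: triple_linear_simps triple_scaleC_right xxz scaleC_add_right scaleC_scaleC \<mu>
        flip: z_def)
  have minus: "triple x x (z - \<mu> *\<^sub>C x) = (- \<mu>) *\<^sub>C (z - \<mu> *\<^sub>C x)"
    by (simp add: triple_linear_simps triple_scaleC_right xxz scaleC_scaleC \<mu>
        complex_vector.scale_right_diff_distrib flip: z_def)
  have "\<not> (\<mu> \<in> \<real>\<^sub>\<ge>\<^sub>0 \<and> - \<mu> \<in> \<real>\<^sub>\<ge>\<^sub>0)"
    using \<open>\<mu> \<noteq> 0\<close> by (auto simp: complex_nonneg_Reals_iff complex_eq_iff)
  hence "z + \<mu> *\<^sub>C x = 0 \<or> z - \<mu> *\<^sub>C x = 0"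
    using eigenvalue_nonneg[OF plus] eigenvalue_nonneg[OF minus] by blast
  hence "z = (- \<mu>) *\<^sub>C x \<or> z = \<mu> *\<^sub>C x" by (auto simp: eq_neg_iff_add_eq_0)
  then obtain \<nu> where \<nu>: "z = \<nu> *\<^sub>C x" by blast
  have "\<nu> \<in> \<real>\<^sub>\<ge>\<^sub>0" using \<nu> \<open>x \<noteq> 0\<close> by (intro eigenvalue_nonneg[of x x]) (auto simp: z_def)
  moreover have "\<nu> \<noteq> 0" using \<nu> \<open>z \<noteq> 0\<close> by auto
  ultimately obtain r where r: "\<nu> = of_real r" "r > 0"
    by (auto elim!: nonneg_Reals_cases simp: less_le)
  hence zr: "z = r *\<^sub>R x" using \<nu> by (simp add: scaleR_eq_scaleC)
  \<comment> \<open>Scaling by \<open>t\<close> turns \<open>{x,x,x} = r x\<close> into the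
    tripotent equation, since \<open>t^2 r = 1\<close>.\<close>
  define t where "t = 1 / sqrt r"
  have t: "t * t * r = 1" "t \<noteq> 0" using r(2) by (simp_all add: t_def)
  define v where "v = t *\<^sub>R x"
  have vvv: "triple v v v = v"
    using t(1) by (simp add: v_def triple_scaleR zr[unfolded z_def] mult_ac)
  have "triple v v e = 0" by (simp add: v_def triple_linear_simps null)
  hence "triple v v (triple v e v) = 2 *\<^sub>R triple v e v"
    using triple_jordan[of v v v e v] by (simp add: vvv triple_linear_simps scaleR_2)
  hence "triple v e v = 0" by (rule peirce_weight_eq_0[OF vvv]) simp_all
  hence "u = 0" using t(2) by (simp add: v_def u_def triple_linear_simps)
  hence "z = 0" using exu by (simp add: triple_linear_simps)
  thus False using \<open>z \<noteq> 0\<close> by simp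
qed

end

subsection \<open>Automorphisms generated by derivations\<close>

text \<open>The solution is the exponential series of \<open>t D\<close> applied to
  \<open>x\<close>, differentiated term by term. As \<open>D\<close> does not increase norms, the
  terms are dominated on the interval by those of the series for \<open>exp R\<close> times
  \<open>norm x\<close>.\<close>

lemma linear_flow_exists:
  fixes D :: "'a::banach \<Rightarrow> 'a"
  assumes D: "bounded_linear D" and contr: "\<And>x. norm (D x) \<le> norm x"
  shows "\<exists>u. u 0 = x \<and> (\<forall>t\<in>{-R<..<R::real}. (u has_vector_derivative D (u t)) (at t))"
proof (cases "R > 0")
  case True
  define a where "a = (\<lambda>n. (D ^^ n) x)"
  have na: "norm (a n) \<le> norm x" for n
    by (induction n) (auto simp: a_def intro: order_trans[OF contr])
  define S where "S = {-R<..<R}"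
  \<comment> \<open>The derivative of the n-th term: the index drops by one, and the constant term
    contributes 0. The majorant \<open>M\<close> has the same shift.\<close>
  define c where "c = (\<lambda>n t. case n of 0 \<Rightarrow> 0 | Suc m \<Rightarrow> (t ^ m / fact m) *\<^sub>R a (Suc m))"
  define u where "u = (\<lambda>t. \<Sum>n. (t ^ n / fact n) *\<^sub>R a n)"
  have summ_exp: "summable (\<lambda>m. R ^ m / fact m * norm x)"
    using summable_mult2[OF summable_exp[of R], of "norm x"] by (simp add: field_simps)
  have bound: "norm ((t ^ m / fact m) *\<^sub>R a k) \<le> R ^ m / fact m * norm x" if "t \<in> S" for t m k
  proof -
    have "\<bar>t ^ m\<bar> \<le> R ^ m"
      using that unfolding S_def power_abs by (intro power_mono) auto
    hence "\<bar>t ^ m\<bar> / fact m * norm (a k) \<le> R ^ m / fact m * norm x"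
      using na[of k] True by (intro mult_mono divide_right_mono) auto
    thus ?thesis by simp
  qed
  have summ: "summable (\<lambda>n. (t ^ n / fact n) *\<^sub>R a n)" if "t \<in> S" for t
    using bound[OF that] by (intro summable_comparison_test'[OF summ_exp]) auto
  define M where "M = (\<lambda>n. case n of 0 \<Rightarrow> 0 | Suc m \<Rightarrow> R ^ m / fact m * norm x)"
  have "summable M" using summ_exp by (subst summable_Suc_iff[symmetric]) (simp add: M_def)
  have cM: "norm (c n t) \<le> M n" if "t \<in> S" for n t
    using bound[OF that] by (cases n) (auto simp: c_def M_def)
  have unif: "uniform_limit S (\<lambda>n t. \<Sum>i<n. c i t) (\<lambda>t. \<Sum>i. c i t) sequentially"
    using cM \<open>summable M\<close> by (rule Weierstrass_m_test)
  have sum_c: "(\<Sum>i. c i t) = D (u t)" if "t \<in> S" for t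
  proof -
    have "summable (\<lambda>i. c i t)"
      using cM[OF that] by (intro summable_comparison_test'[OF \<open>summable M\<close>]) auto
    hence "(\<Sum>i. c i t) = (\<Sum>i. c (Suc i) t)"
      by (subst suminf_split_head) (auto simp: c_def)
    also have "\<dots> = (\<Sum>n. D ((t ^ n / fact n) *\<^sub>R a n))"
      using linear_simps(5)[OF D] by (simp add: c_def a_def)
    also have "\<dots> = D (u t)"
      unfolding u_def by (rule bounded_linear.suminf[OF D summ[OF that], symmetric])
    finally show ?thesis .
  qed
  have deriv: "((\<lambda>t. (t ^ n / fact n) *\<^sub>R a n) has_derivative (\<lambda>h. h *\<^sub>R c n t)) (at t within S)" for n t
  proof (cases n)
    case (Suc m)
    have "((\<lambda>t::real. t ^ Suc m / fact (Suc m)) has_field_derivative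
        (real (Suc m) * t ^ m) / fact (Suc m)) (at t within S)"
      using DERIV_cdivide[OF DERIV_pow[of "Suc m" t S], of "fact (Suc m)"]
      by (simp del: fact_Suc of_nat_Suc power_Suc)
    also have "(real (Suc m) * t ^ m) / fact (Suc m) = t ^ m / fact m"
      by (simp add: divide_simps)
    finally have "((\<lambda>t::real. t ^ Suc m / fact (Suc m)) has_derivative (\<lambda>h. h * (t ^ m / fact m)))
        (at t within S)"
      by (simp only: has_field_derivative_def mult_commute_abs)
    from has_derivative_scaleR_left[OF this, of "a n"] show ?thesis
      using Suc by (simp add: c_def)
  qed (simp add: c_def)
  have "\<forall>\<^sub>F n in sequentially. \<forall>t\<in>S. \<forall>h.
      norm ((\<Sum>i<n. h *\<^sub>R c i t) - h *\<^sub>R D (u t)) \<le> \<epsilon> * norm h" if "\<epsilon> > 0" for \<epsilon>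
    using uniform_limitD[OF unif that]
  proof eventually_elim
    case (elim n)
    show ?case
    proof (intro ballI allI)
      fix t h :: real assume t: "t \<in> S"
      have "norm ((\<Sum>i<n. h *\<^sub>R c i t) - h *\<^sub>R D (u t)) = \<bar>h\<bar> * norm ((\<Sum>i<n. c i t) - D (u t))"
        by (simp flip: scaleR_sum_right scaleR_right_diff_distrib)
      also have "\<dots> \<le> \<bar>h\<bar> * \<epsilon>"
        using elim t sum_c[OF t] by (intro mult_left_mono) (auto simp: dist_norm less_imp_le)
      finally show "norm ((\<Sum>i<n. h *\<^sub>R c i t) - h *\<^sub>R D (u t)) \<le> \<epsilon> * norm h"
        by (simp add: mult.commute)
    qed
  qed
  moreover have "convex S" "0 \<in> S" using True by (auto simp: S_def)
  ultimately obtain g where g: "\<And>t. t \<in> S \<Longrightarrow> (\<lambda>n. (t ^ n / fact n) *\<^sub>R a n) sums g t"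
    "\<And>t. t \<in> S \<Longrightarrow> (g has_derivative (\<lambda>h. h *\<^sub>R D (u t))) (at t within S)"
    using has_derivative_series[of S "\<lambda>n t. (t ^ n / fact n) *\<^sub>R a n" "\<lambda>n t h. h *\<^sub>R c n t"
        "\<lambda>t h. h *\<^sub>R D (u t)" 0] deriv summable_sums[OF summ[OF \<open>0 \<in> S\<close>]] by blast
  have gu: "g t = u t" if "t \<in> S" for t
    unfolding u_def by (rule sums_unique[OF g(1)[OF that]])
  have "(\<lambda>n. (0 ^ n / fact n) *\<^sub>R a n) sums a 0"
    using sums_If_finite[of "\<lambda>n. n = 0" a] by (simp add: power_0_left if_distrib if_distribR cong: if_cong)
  hence "u 0 = a 0" unfolding u_def by (rule sums_unique[symmetric])
  have "(g has_vector_derivative D (g t)) (at t)" if "t \<in> S" for t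
    using g(2)[OF that] that gu[OF that] at_within_open[of t S]
    by (simp add: has_vector_derivative_def S_def)
  moreover have "g 0 = x" using gu[OF \<open>0 \<in> S\<close>] \<open>u 0 = a 0\<close> by (simp add: a_def)
  ultimately show ?thesis unfolding S_def by blast
qed auto

text \<open>At a point \<open>m\<close> where the difference \<open>h\<close> has maximal norm, the
  mean value inequality from 0 gives \<open>norm (h m) \<le> 1/2 * norm (h m)\<close>.\<close>

lemma linear_flow_unique:
  fixes D :: "'a::real_normed_vector \<Rightarrow> 'a"
  assumes D: "linear D" and contr: "\<And>x. norm (D x) \<le> 1/2 * norm x"
    and f: "\<And>t. t \<in> {-1..1::real} \<Longrightarrow> (f has_vector_derivative D (f t)) (at t within {-1..1})"
    and g: "\<And>t. t \<in> {-1..1::real} \<Longrightarrow> (g has_vector_derivative D (g t)) (at t within {-1..1})"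
    and "f 0 = g 0" and t: "t \<in> {-1..1}"
  shows "f t = g t"
proof -
  define h where "h = (\<lambda>t. f t - g t)"
  have h: "(h has_vector_derivative D (h t)) (at t within {-1..1})" if "t \<in> {-1..1}" for t
    unfolding h_def linear_diff[OF D] using f[OF that] g[OF that]
    by (rule has_vector_derivative_diff)
  have "continuous_on {-1..1} h"
    using h has_vector_derivative_continuous continuous_on_eq_continuous_within by blast
  hence "continuous_on {-1..1} (\<lambda>t. norm (h t))" by (rule continuous_on_norm)
  then obtain m where m: "m \<in> {-1..1}" "\<And>t. t \<in> {-1..1} \<Longrightarrow> norm (h t) \<le> norm (h m)"
    using continuous_attains_sup[of "{-1..1::real}" "\<lambda>t. norm (h t)"] by auto
  have onorm: "onorm (\<lambda>s::real. s *\<^sub>R D (h t)) \<le> 1/2 * norm (h m)" if "t \<in> {-1..1}" for t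
  proof (rule onorm_le)
    fix s :: real
    have "norm (D (h t)) \<le> 1/2 * norm (h m)" using contr[of "h t"] m(2)[OF that] by linarith
    hence "\<bar>s\<bar> * norm (D (h t)) \<le> \<bar>s\<bar> * (1/2 * norm (h m))" by (rule mult_left_mono) simp
    thus "norm (s *\<^sub>R D (h t)) \<le> 1/2 * norm (h m) * norm s" by (simp add: mult.commute)
  qed
  have "norm (h m - h 0) \<le> 1/2 * norm (h m) * norm (m - 0)"
    using h onorm m(1) unfolding has_vector_derivative_def
    by (intro differentiable_bound[where S = "{-1..1}" and f' = "\<lambda>t s. s *\<^sub>R D (h t)"]) auto
  also have "\<dots> \<le> 1/2 * norm (h m) * 1" using m(1) by (intro mult_left_mono) auto
  finally have "norm (h m) = 0" using \<open>f 0 = g 0\<close> by (simp add: h_def)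
  thus ?thesis using m(2)[OF t] by (simp add: h_def)
qed

context jb_triple
begin

text \<open>The parameter is real, so the conjugate-linear middle variable behaves like the others.
  The product is the bounded bilinear map \<open>(a, b) \<mapsto> L(a,b)\<close> followed by
  evaluation.\<close>

lemma has_vector_derivative_triple:
  assumes "(x has_vector_derivative x') (at t within S)" "(y has_vector_derivative y') (at t within S)"
    "(z has_vector_derivative z') (at t within S)"
  shows "((\<lambda>t. triple (x t) (y t) (z t)) has_vector_derivative
    triple x' (y t) (z t) + triple (x t) y' (z t) + triple (x t) (y t) z') (at t within S)"
proof -
  obtain K where K: "K \<ge> 0" "\<And>a b c. norm (triple a b c) \<le> K * norm a * norm b * norm c"
    using triple_bounded by blast
  have blin: "bounded_linear (triple a b)" for a b
  proof (rule bounded_linear_intro[where K = "K * norm a * norm b"])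
    show "norm (triple a b c) \<le> norm c * (K * norm a * norm b)" for c
      using K(2)[of a b c] by (simp add: mult.commute)
  qed (simp_all add: triple_linear_simps)
  define B where "B = (\<lambda>a b. Blinfun (triple a b))"
  have B: "blinfun_apply (B a b) c = triple a b c" for a b c
    unfolding B_def by (simp add: bounded_linear_Blinfun_apply[OF blin])
  have bil: "bounded_bilinear B"
  proof
    show "\<exists>K. \<forall>a b. norm (B a b) \<le> norm a * norm b * K"
      using K by (intro exI[of _ K] allI norm_blinfun_bound) (auto simp: B mult_ac)
  qed (auto intro!: blinfun_eqI simp: B triple_linear_simps blinfun.bilinear_simps)
  show ?thesis
    using bounded_bilinear.has_vector_derivative[OF bounded_bilinear_blinfun_apply
        bounded_bilinear.has_vector_derivative[OF bil assms(1,2)] assms(3)]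
    by (simp add: B blinfun.bilinear_simps add_ac)
qed

text \<open>The exponential of a derivation is an automorphism of the triple.\<close>

lemma derivation_orbit:
  assumes D: "bounded_linear D" and contr: "\<And>x. norm (D x) \<le> 1/2 * norm x"
    and hom: "\<And>c x. D (c *\<^sub>C x) = c *\<^sub>C D x"
    and der: "\<And>x y z. D (triple x y z) = triple (D x) y z + triple x (D y) z + triple x y (D z)"
    and e: "e \<in> min_tripotents triple"
  shows "\<exists>u. u 0 = e \<and> (u has_vector_derivative D e) (at (0::real)) \<and>
    (\<forall>t\<in>{-1..1}. u t \<in> min_tripotents triple)"
proof -
  have "norm (D x) \<le> norm x" for x using contr[of x] norm_ge_zero[of x] by linarith
  \<comment> \<open>The radius 3 leaves room for the shifted times \<open>t + s\<close> in
    \<open>U_inv\<close>, which range over [-2, 2].\<close>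
  hence "\<exists>u. u 0 = x \<and> (\<forall>t\<in>{-3<..<3::real}. (u has_vector_derivative D (u t)) (at t))" for x
    by (rule linear_flow_exists[OF D])
  then obtain U where U0: "\<And>x. U x 0 = x"
    and U: "\<And>x t. t \<in> {-3<..<3::real} \<Longrightarrow> (U x has_vector_derivative D (U x t)) (at t)"
    by metis
  have U': "(U x has_vector_derivative D (U x t)) (at t within {-1..1})" if "t \<in> {-1..1}" for x t
    by (rule has_vector_derivative_at_within[OF U]) (use that in auto)
  \<comment> \<open>The homomorphism and inverse properties of the flow all follow from this: both
    sides solve the same equation with the same initial value.\<close>
  have uniq: "f t = U (f 0) t"
    if f: "\<And>t. t \<in> {-1..1} \<Longrightarrow> (f has_vector_derivative D (f t)) (at t within {-1..1})"
      and t: "t \<in> {-1..1}" for f t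
  proof (rule linear_flow_unique[where D = D])
    show "linear D" using D by (rule bounded_linear.linear)
    show "f 0 = U (f 0) 0" by (simp only: U0)
  qed (fact contr f U' t)+
  have U_scale: "U (c *\<^sub>C x) t = c *\<^sub>C U x t" if t: "t \<in> {-1..1}" for c x t
  proof -
    have bl: "bounded_linear (\<lambda>y::'a. c *\<^sub>C y)"
      by (intro bounded_linear_intro[where K = "cmod c"])
        (auto simp: scaleC_add_right scaleC_scaleR norm_scaleC mult.commute)
    have "c *\<^sub>C U x t = U (c *\<^sub>C U x 0) t"
    proof (rule uniq[OF _ t])
      fix t :: real assume "t \<in> {-1..1}"
      from bounded_linear.has_vector_derivative[OF bl U'[OF this, of x]]
      show "((\<lambda>t. c *\<^sub>C U x t) has_vector_derivative D (c *\<^sub>C U x t)) (at t within {-1..1})"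
        by (simp only: hom)
    qed
    thus ?thesis by (simp add: U0)
  qed
  have U_triple: "triple (U x t) (U y t) (U z t) = U (triple x y z) t" if t: "t \<in> {-1..1}" for x y z t
  proof -
    have "triple (U x t) (U y t) (U z t) = U (triple (U x 0) (U y 0) (U z 0)) t"
    proof (rule uniq[OF _ t])
      fix t :: real assume "t \<in> {-1..1}"
      note U'[OF this]
      from has_vector_derivative_triple[OF this[of x] this[of y] this[of z]]
      show "((\<lambda>t. triple (U x t) (U y t) (U z t)) has_vector_derivative
          D (triple (U x t) (U y t) (U z t))) (at t within {-1..1})"
        by (simp only: der)
    qed
    thus ?thesis by (simp add: U0)
  qed
  have U_inv: "U (U x t) (- t) = x" if t: "t \<in> {-1..1}" for x t
  proof -
    have "((\<lambda>s. U x (t + s)) has_vector_derivative D (U x (t + s))) (at s within {-1..1})"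
      if s: "s \<in> {-1..1}" for s
    proof -
      have 1: "((+) t has_vector_derivative 1) (at s within {-1..1})"
        unfolding has_vector_derivative_def by (auto intro!: derivative_eq_intros)
      have 2: "(U x has_vector_derivative D (U x (t + s))) (at (t + s) within (+) t ` {-1..1})"
        by (rule has_vector_derivative_at_within[OF U]) (use s t in auto)
      show ?thesis using vector_diff_chain_within[OF 1 2] by (simp add: o_def)
    qed
    hence "U x (t + - t) = U (U x (t + 0)) (- t)" by (rule uniq) (use t in auto)
    thus ?thesis by (simp add: U0)
  qed
  have "U e t \<in> min_tripotents triple" if t: "t \<in> {-1..1}" for t
    unfolding min_tripotents_iff
  proof (intro conjI allI impI)
    have t': "- t \<in> {-1..1}" using t by auto
    show "triple (U e t) (U e t) (U e t) = U e t"
      by (simp add: U_triple[OF t] min_tripotentD(1)[OF e])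
    show "U e t \<noteq> 0"
    proof
      assume "U e t = 0"
      hence "U (0 *\<^sub>C (0::'a)) (- t) = e" using U_inv[OF t, of e] by simp
      hence "e = 0" unfolding U_scale[OF t'] by simp
      thus False using min_tripotentD(2)[OF e] by simp
    qed
    fix w assume w: "triple (U e t) (U e t) w = w"
    \<comment> \<open>Minimality is transported by pulling \<open>w\<close> back along the flow to
      the Peirce space \<open>E_2(e)\<close>.\<close>
    define v where "v = U w (- t)"
    have "w = U v t" using U_inv[OF t', of w] by (simp add: v_def)
    hence "U (triple e e v) t = U v t" using w U_triple[OF t, of e e v] by simp
    hence "triple e e v = v" using U_inv[OF t] by metis
    then obtain c where "v = c *\<^sub>C e" using min_tripotentD(4)[OF e] by blast
    thus "\<exists>c. w = c *\<^sub>C U e t" using \<open>w = U v t\<close> U_scale[OF t] by auto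
  qed
  moreover have "(U e has_vector_derivative D e) (at 0)" using U[of 0 e] U0 by simp
  ultimately show ?thesis using U0 by (intro exI[of _ "U e"]) auto
qed

end

subsection \<open>Separation of points of the socle\<close>

context jb_triple
begin

text \<open>Differentiating \<open>{e\<^sub>t,y,e\<^sub>t} = 0\<close> along the orbit of \<open>e\<close> under \<open>exp (t (L(x,e) - L(e,x)))\<close>,
  where \<open>x\<close> is the component of \<open>y\<close> in \<open>E\<^sub>1(e)\<close>, gives \<open>{x,y,e} = 0\<close>.\<close>

lemma peirce_0_if_annihilated:
  assumes ann: "\<And>v. v \<in> min_tripotents triple \<Longrightarrow> triple v y v = 0"
    and e: "e \<in> min_tripotents triple"
  shows "triple e e y = 0"
proof -
  note te = min_tripotentD(1)[OF e] and ne = min_tripotentD(3)[OF e]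
  obtain K where K: "K \<ge> 0" "\<And>a b c. norm (triple a b c) \<le> K * norm a * norm b * norm c"
    using triple_bounded by blast
  define x where "x = 2 *\<^sub>R triple e e y"
  have "2 *\<^sub>R triple e e (triple e e y) = triple e e y"
    using Q_squared[OF te, of y] ann[OF e] by (simp add: triple_linear_simps)
  hence x1: "triple e e x = (1/2) *\<^sub>R x" by (simp add: x_def triple_linear_simps)
  have Qx: "triple e x e = 0"
    using Q_L[OF te, of y] ann[OF e] by (simp add: x_def triple_linear_simps)
  have xee: "triple x e e = (1/2) *\<^sub>R x" using x1 triple_symmetric by metis
  \<comment> \<open>Makes the derivation \<open>D\<close> a contraction by 1/2, as
    \<open>derivation_orbit\<close> requires; the added 1 covers
    \<open>K * norm x = 0\<close>.\<close>
  define \<delta> where "\<delta> = 1 / (4 * (K * norm x + 1))"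
  have "K * norm x \<ge> 0" using K(1) by simp
  hence \<delta>: "\<delta> > 0" "\<delta> * (K * norm x) \<le> 1/4" by (simp_all add: \<delta>_def field_simps)
  define D where "D = (\<lambda>w. \<delta> *\<^sub>R (triple x e w - triple e x w))"
  have contr: "norm (D w) \<le> 1/2 * norm w" for w
  proof -
    have "norm (triple x e w - triple e x w) \<le> norm (triple x e w) + norm (triple e x w)"
      by (rule norm_triangle_ineq4)
    also have "\<dots> \<le> 2 * (K * norm x * norm w)" using K(2)[of x e w] K(2)[of e x w] ne by simp
    finally have "norm (D w) \<le> \<delta> * (2 * (K * norm x * norm w))"
      using \<delta>(1) by (simp add: D_def mult_left_mono)
    also have "\<dots> = 2 * (\<delta> * (K * norm x)) * norm w" by simp
    also have "\<dots> \<le> 2 * (1/4) * norm w"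
      using \<delta>(2) by (intro mult_right_mono mult_left_mono) auto
    finally show ?thesis by simp
  qed
  have D: "bounded_linear D"
    using contr by (intro bounded_linear_intro[where K = "1/2"])
      (simp_all add: D_def triple_linear_simps scaleR_right_diff_distrib scaleR_right_distrib
        mult.commute)
  have hom: "D (c *\<^sub>C w) = c *\<^sub>C D w" for c w
    by (simp add: D_def triple_scaleC_right scaleC_scaleR complex_vector.scale_right_diff_distrib)
  \<comment> \<open>In \<open>L(x,e) - L(e,x)\<close> the swap of arguments in the middle term of
    the Jordan identity compensates its minus sign.\<close>
  have der: "D (triple a b c) = triple (D a) b c + triple a (D b) c + triple a b (D c)" for a b c
    unfolding D_def triple_jordan[of x e a b c] triple_jordan[of e x a b c]
    by (simp add: triple_linear_simps scaleR_right_diff_distrib scaleR_right_distrib)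
  obtain u where u: "u 0 = e" "(u has_vector_derivative D e) (at (0::real))"
    "\<And>t. t \<in> {-1..1} \<Longrightarrow> u t \<in> min_tripotents triple"
    using derivation_orbit[OF D contr hom der e] by blast
  have "((\<lambda>t. triple (u t) y (u t)) has_vector_derivative
      triple (D e) y e + triple e 0 e + triple e y (D e)) (at 0)"
    using has_vector_derivative_triple[OF u(2) has_vector_derivative_const[of y] u(2)]
    by (simp add: u(1))
  moreover have "((\<lambda>t. triple (u t) y (u t)) has_vector_derivative 0) (at 0)"
    by (rule has_vector_derivative_transform_within_open[where S = "{-1<..<1}" and f = "\<lambda>_. 0"])
      (auto simp: ann u(3))
  ultimately have "triple (D e) y e + triple e 0 e + triple e y (D e) = 0"
    by (rule vector_derivative_unique_at)
  moreover have "D e = (\<delta> / 2) *\<^sub>R x" by (simp add: D_def xee Qx)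
  moreover have "triple e y x = triple x y e" by (rule triple_symmetric)
  ultimately have "(\<delta> / 2) *\<^sub>R triple x y e + (\<delta> / 2) *\<^sub>R triple x y e = 0"
    by (simp add: triple_linear_simps)
  hence xye: "triple x y e = 0" using \<delta>(1) by (simp flip: scaleR_left_distrib)
  \<comment> \<open>The remainder \<open>y - x\<close> lies in \<open>E_0(e)\<close>, so
    \<open>{e,y-x,x}\<close> has the forbidden weight 1 - 0 + 1/2 = 3/2. Thus \<open>y\<close> may
    be replaced by \<open>x\<close> in \<open>{x,y,e} = 0\<close>.\<close>
  have "triple e e (y - x) = 0 *\<^sub>R (y - x)" by (simp add: triple_linear_simps x1) (simp add: x_def)
  from peirce_weight[OF te _ this x1, of e 1] have "triple e (y - x) x = 0"
    using te by (intro peirce_weight_eq_0[OF te, of _ "3/2"]) simp_all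
  hence "triple x (y - x) e = 0" using triple_symmetric by metis
  hence "triple x x e = 0" using xye by (simp add: triple_linear_simps)
  hence "x = 0" by (rule peirce_1_null_eq_0[OF e x1])
  thus ?thesis by (simp add: x_def)
qed

text \<open>The product \<open>{e,y,y}\<close> has weight 1, hence is some \<open>c e\<close>.
  Expanding \<open>{y,e,{e,y,e}}\<close> by the Jordan identity, all other terms vanish and
  \<open>{e,c e,e} = 0\<close> remains.\<close>

lemma peirce_0_orthogonal:
  assumes e: "e \<in> min_tripotents triple" and y: "triple e e y = 0"
  shows "triple e y y = 0"
proof -
  note te = min_tripotentD(1)[OF e]
  have y0: "triple e e y = 0 *\<^sub>R y" and e1: "triple e e e = 1 *\<^sub>R e" using y te by simp_all
  have "triple e e (triple e y y) = triple e y y" using peirce_weight[OF te e1 y0 y0] by simp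
  then obtain c where c: "triple e y y = c *\<^sub>C e" using min_tripotentD(4)[OF e] by blast
  have "triple e y e = 0"
    using peirce_weight[OF te e1 y0 e1] by (intro peirce_weight_eq_0[OF te, of _ 2]) simp_all
  moreover have "triple y e e = 0" using y triple_symmetric by metis
  ultimately have "triple e (c *\<^sub>C e) e = 0"
    using jordan_identity[of y e e y e] by (simp add: c triple_linear_simps)
  hence "cnj c *\<^sub>C e = 0" by (simp add: triple_scaleC_middle te)
  hence "c = 0" using min_tripotentD(2)[OF e] by simp
  thus ?thesis using c by simp
qed

text \<open>\<open>{w,y,y}\<close> is linear in \<open>w\<close> and vanishes at minimal tripotents,
  hence on the socle, in particular at \<open>w = y\<close>.\<close>

lemma soc_eq_0_if_peirce_coords_0:
  assumes "y \<in> soc triple" and "\<And>v. v \<in> min_tripotents triple \<Longrightarrow> peirce_coord v y = 0"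
  shows "y = 0"
proof -
  have "triple w y y = 0" if "w \<in> cspan (min_tripotents triple)" for w
    using that
  proof (induction rule: complex_vector.span_induct_alt)
    case base
    show ?case by (simp add: triple_linear_simps)
  next
    case (step c e w)
    have "triple e e y = 0"
      using assms(2) step(1) by (intro peirce_0_if_annihilated) (simp_all add: peirce_coord_eq_0_iff)
    hence "triple e y y = 0" using step(1) peirce_0_orthogonal by blast
    thus ?case using step by (simp add: triple_linear_simps triple_scaleC_left)
  qed
  hence "triple y y y = 0" using assms(1) by (simp add: soc_def)
  thus ?thesis by (simp add: triple_cube_eq_0_iff)
qed

end

text \<open>If \<open>x\<close> is a combination of minimal tripotents, the same combination of
  their images serves as \<open>z\<close>. The lemma is applied to \<Phi> for existence and to its
  inverse for surjectivity.\<close>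

lemma soc_transfer_exists:
  assumes M: "jb_triple triple\<^sub>M" and N: "jb_triple triple\<^sub>N"
    and \<Phi>: "\<Phi> ` min_tripotents triple\<^sub>M \<subseteq> min_tripotents triple\<^sub>N"
    and pres: "\<And>e v. e \<in> min_tripotents triple\<^sub>M \<Longrightarrow> v \<in> min_tripotents triple\<^sub>M \<Longrightarrow>
      jb_triple.peirce_coord triple\<^sub>N (\<Phi> e) (\<Phi> v) = jb_triple.peirce_coord triple\<^sub>M e v"
    and x: "x \<in> soc triple\<^sub>M"
  shows "\<exists>z\<in>soc triple\<^sub>N. \<forall>e\<in>min_tripotents triple\<^sub>M.
    jb_triple.peirce_coord triple\<^sub>N (\<Phi> e) z = jb_triple.peirce_coord triple\<^sub>M e x"
proof -
  interpret M: jb_triple triple\<^sub>M by (rule M)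
  interpret N: jb_triple triple\<^sub>N by (rule N)
  have \<Phi>': "\<Phi> e \<in> min_tripotents triple\<^sub>N" if "e \<in> min_tripotents triple\<^sub>M" for e
    using \<Phi> that by blast
  have coord_0: "M.peirce_coord e 0 = 0" if "e \<in> min_tripotents triple\<^sub>M" for e
    using M.peirce_coord_scaleC[OF that, of 0 0] by simp
  have coord_0': "N.peirce_coord e 0 = 0" if "e \<in> min_tripotents triple\<^sub>N" for e
    using N.peirce_coord_scaleC[OF that, of 0 0] by simp
  show ?thesis using x unfolding soc_def
  proof (induction rule: complex_vector.span_induct_alt)
    case base
    show ?case by (rule bexI[of _ 0]) (simp_all add: complex_vector.span_zero coord_0 coord_0' \<Phi>')
  next
    case (step c v x)
    then obtain z where z: "z \<in> cspan (min_tripotents triple\<^sub>N)"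
      "\<And>e. e \<in> min_tripotents triple\<^sub>M \<Longrightarrow> N.peirce_coord (\<Phi> e) z = M.peirce_coord e x"
      by blast
    show ?case
    proof (rule bexI[of _ "c *\<^sub>C \<Phi> v + z"])
      show "c *\<^sub>C \<Phi> v + z \<in> cspan (min_tripotents triple\<^sub>N)"
        by (intro complex_vector.span_add complex_vector.span_scale z(1)
            complex_vector.span_base[OF \<Phi>'[OF step(1)]])
      show "\<forall>e\<in>min_tripotents triple\<^sub>M.
          N.peirce_coord (\<Phi> e) (c *\<^sub>C \<Phi> v + z) = M.peirce_coord e (c *\<^sub>C v + x)"
        using z(2) step(1) pres
        by (simp add: \<Phi>' N.peirce_coord_add N.peirce_coord_scaleC M.peirce_coord_add
            M.peirce_coord_scaleC)
    qed
  qed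
qed

theorem theorem2p3:
  fixes triple\<^sub>M :: "'a::complex_banach triple_product"
    and predual\<^sub>M :: "('a \<Rightarrow>\<^sub>L complex) set"
    and triple\<^sub>N :: "'b::complex_banach triple_product"
    and predual\<^sub>N :: "('b \<Rightarrow>\<^sub>L complex) set"
    and \<Phi> :: "'a \<Rightarrow> 'b"
  assumes "atomic_jbw_triple triple\<^sub>M predual\<^sub>M"
    and "atomic_jbw_triple triple\<^sub>N predual\<^sub>N"
    and "bij_betw \<Phi> (min_tripotents triple\<^sub>M) (min_tripotents triple\<^sub>N)"
    and "\<And>e v. e \<in> min_tripotents triple\<^sub>M \<Longrightarrow> v \<in> min_tripotents triple\<^sub>M \<Longrightarrow>
      TTP triple\<^sub>N predual\<^sub>N (\<Phi> v) (\<Phi> e) = TTP triple\<^sub>M predual\<^sub>M v e"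
  shows "\<exists>T\<^sub>0 :: 'a \<Rightarrow> 'b.
    bij_betw T\<^sub>0 (soc triple\<^sub>M) (soc triple\<^sub>N) \<and>
    (\<forall>x\<in>soc triple\<^sub>M. \<forall>y\<in>soc triple\<^sub>M. T\<^sub>0 (x + y) = T\<^sub>0 x + T\<^sub>0 y) \<and>
    (\<forall>c. \<forall>x\<in>soc triple\<^sub>M. T\<^sub>0 (c *\<^sub>C x) = c *\<^sub>C T\<^sub>0 x) \<and>
    (\<forall>e\<in>min_tripotents triple\<^sub>M. T\<^sub>0 e = \<Phi> e)"
proof -
  interpret M: atomic_jbw_triple triple\<^sub>M predual\<^sub>M by (rule assms(1))
  interpret N: atomic_jbw_triple triple\<^sub>N predual\<^sub>N by (rule assms(2))
  let ?UM = "min_tripotents triple\<^sub>M" and ?UN = "min_tripotents triple\<^sub>N"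
  have \<Phi>: "\<Phi> e \<in> ?UN" if "e \<in> ?UM" for e using assms(3) that by (rule bij_betw_apply)
  have pres: "N.peirce_coord (\<Phi> e) (\<Phi> v) = M.peirce_coord e v" if "e \<in> ?UM" "v \<in> ?UM" for e v
    using assms(4)[OF that] by (simp add: N.TTP_eq[OF \<Phi>[OF that(1)]] M.TTP_eq[OF that(1)])
  define \<Psi> where "\<Psi> = the_inv_into ?UM \<Phi>"
  have \<Psi>: "\<Psi> f \<in> ?UM" "\<Phi> (\<Psi> f) = f" if "f \<in> ?UN" for f
    using that assms(3) the_inv_into_into[of \<Phi> ?UM f ?UM] f_the_inv_into_f[of \<Phi> ?UM f]
    by (auto simp: \<Psi>_def bij_betw_def)
  \<comment> \<open>The graph of the desired map. It is a linear subspace, so single-valuedness and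
    injectivity reduce to pairs with one entry 0.\<close>
  define R where "R = (\<lambda>x z. x \<in> soc triple\<^sub>M \<and> z \<in> soc triple\<^sub>N \<and>
    (\<forall>e\<in>?UM. N.peirce_coord (\<Phi> e) z = M.peirce_coord e x))"
  have R_add: "R (x + y) (z + w)" if "R x z" "R y w" for x y z w
    using that \<Phi> by (auto simp: R_def soc_def complex_vector.span_add M.peirce_coord_add
        N.peirce_coord_add)
  have R_scale: "R (c *\<^sub>C x) (c *\<^sub>C z)" if "R x z" for c x z
    using that \<Phi> by (auto simp: R_def soc_def complex_vector.span_scale M.peirce_coord_scaleC
        N.peirce_coord_scaleC)
  have R_diff: "R (x - y) (z - w)" if "R x z" "R y w" for x y z w
    using R_add[OF that(1) R_scale[OF that(2), of "-1"]] by simp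
  \<comment> \<open>Every minimal tripotent \<open>f\<close> of the target is
    \<open>\<Phi> (\<Psi> f)\<close>, so all coordinates of \<open>z\<close> vanish and separation
    applies.\<close>
  have R_0_right: "z = 0" if "R 0 z" for z
  proof (rule N.soc_eq_0_if_peirce_coords_0)
    show "z \<in> soc triple\<^sub>N" using that by (simp add: R_def)
    fix f assume f: "f \<in> ?UN"
    have "N.peirce_coord (\<Phi> (\<Psi> f)) z = M.peirce_coord (\<Psi> f) 0"
      using that \<Psi>(1)[OF f] by (simp add: R_def)
    thus "N.peirce_coord f z = 0"
      using \<Psi>[OF f] M.peirce_coord_scaleC[OF \<Psi>(1)[OF f], of 0 0] by simp
  qed
  have R_0_left: "x = 0" if "R x 0" for x
  proof (rule M.soc_eq_0_if_peirce_coords_0)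
    show "x \<in> soc triple\<^sub>M" using that by (simp add: R_def)
    fix e assume e: "e \<in> ?UM"
    have "N.peirce_coord (\<Phi> e) 0 = M.peirce_coord e x" using that e by (simp add: R_def)
    thus "M.peirce_coord e x = 0" using N.peirce_coord_scaleC[OF \<Phi>[OF e], of 0 0] by simp
  qed
  have R_unique: "z = w" if "R x z" "R x w" for x z w
    using R_0_right[of "z - w"] R_diff[OF that] by simp
  have R_inj: "x = y" if "R x z" "R y z" for x y z
    using R_0_left[of "x - y"] R_diff[OF that] by simp
  have R_total: "\<exists>z. R x z" if "x \<in> soc triple\<^sub>M" for x
    using soc_transfer_exists[OF M.jb_triple_axioms N.jb_triple_axioms _ _ that, of \<Phi>] \<Phi> pres that
    unfolding R_def by blast
  have R_onto: "\<exists>x. R x z" if "z \<in> soc triple\<^sub>N" for z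
  proof -
    have "\<exists>x\<in>soc triple\<^sub>M. \<forall>f\<in>?UN. M.peirce_coord (\<Psi> f) x = N.peirce_coord f z"
    proof (rule soc_transfer_exists[OF N.jb_triple_axioms M.jb_triple_axioms _ _ that])
      show "\<Psi> ` ?UN \<subseteq> ?UM" using \<Psi>(1) by blast
      show "M.peirce_coord (\<Psi> f) (\<Psi> g) = N.peirce_coord f g" if "f \<in> ?UN" "g \<in> ?UN" for f g
        using pres[OF \<Psi>(1)[OF that(1)] \<Psi>(1)[OF that(2)]] \<Psi>(2) that by simp
    qed
    then obtain x where x: "x \<in> soc triple\<^sub>M"
      "\<And>f. f \<in> ?UN \<Longrightarrow> M.peirce_coord (\<Psi> f) x = N.peirce_coord f z" by blast
    have "\<Psi> (\<Phi> e) = e" if "e \<in> ?UM" for e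
      using assms(3) that by (simp add: \<Psi>_def bij_betw_def the_inv_into_f_f)
    hence "R x z" using x \<Phi> that unfolding R_def by metis
    thus ?thesis by blast
  qed
  define T where "T = (\<lambda>x. THE z. R x z)"
  have T_eq: "T x = z" if "R x z" for x z
    unfolding T_def using that R_unique by blast
  have RT: "R x (T x)" if "x \<in> soc triple\<^sub>M" for x
    using R_total[OF that] T_eq by blast
  have "bij_betw T (soc triple\<^sub>M) (soc triple\<^sub>N)"
  proof (rule bij_betw_imageI)
    show "inj_on T (soc triple\<^sub>M)" using RT R_inj by (intro inj_onI) metis
    show "T ` soc triple\<^sub>M = soc triple\<^sub>N"
    proof
      show "T ` soc triple\<^sub>M \<subseteq> soc triple\<^sub>N" using RT by (auto simp: R_def)
      show "soc triple\<^sub>N \<subseteq> T ` soc triple\<^sub>M"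
      proof
        fix z assume "z \<in> soc triple\<^sub>N"
        then obtain x where "R x z" using R_onto by blast
        thus "z \<in> T ` soc triple\<^sub>M" using T_eq[of x z] by (auto simp: R_def)
      qed
    qed
  qed
  moreover have "T (x + y) = T x + T y" if "x \<in> soc triple\<^sub>M" "y \<in> soc triple\<^sub>M" for x y
    by (rule T_eq[OF R_add[OF RT[OF that(1)] RT[OF that(2)]]])
  moreover have "T (c *\<^sub>C x) = c *\<^sub>C T x" if "x \<in> soc triple\<^sub>M" for c x
    by (rule T_eq[OF R_scale[OF RT[OF that]]])
  \<comment> \<open>Preservation of transition pseudo-probabilities says exactly that
    \<open>e\<close> and \<open>\<Phi> e\<close> are related by \<open>R\<close>.\<close>
  moreover have "T e = \<Phi> e" if "e \<in> ?UM" for e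
    using that \<Phi> pres by (intro T_eq) (simp add: R_def soc_def complex_vector.span_base)
  ultimately show ?thesis by blast
qed

end
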